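(* Let $v(x)=\sum_{k=1}^\infty v_k\sqrt2\cos2kx$, where $(v_k)$ is a real sequence, not identically zero, such that $\sum_k|v_k|=\sigma<\infty$ and $kv_k\to0$ as $k\to\infty$. Then, for each $n\in\mathbb{N}$, the $n$-th Dirichlet eigenvalue $E_n(z)$ of the operator $$L(z)y=-y''+zv(x)y,\qquad y(0)=y(\pi)=0,\qquad E_n(0)=n^2,$$ is analytic in a neighborhood of $z=0$, and the radius of convergence $R_n$ of its Taylor series about $z=0$ satisfies, for large enough $n$, $$R_n\le Cn^2,\qquad C=\frac{32\sqrt2\,\sigma}{\|v\|^2}.$$
   Context: The operator $L(z)$ acts in $L^2([0,\pi])$, $z\in\mathbb{C}$. $E_n(z)$ denotes the analytic branch, near $z=0$, of the eigenvalue of $L(z)$ with $E_n(0)=n^2$. The norm is $\|v\|^2=\frac1\pi\int_0^\pi|v(x)|^2dx=\sum_k|v_k|^2$. *)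

theory Defs
  imports "HOL-Complex_Analysis.Complex_Analysis"
begin

text \<open>The coefficients are indexed by positive integers; the value of the sequence at 0 is
  never used.\<close>

definition cosine_potential :: "(nat \<Rightarrow> real) \<Rightarrow> real \<Rightarrow> real" where
  "cosine_potential a x = (\<Sum>k. a (Suc k) * sqrt 2 * cos (2 * real (Suc k) * x))"

definition L2_norm_0_pi :: "(real \<Rightarrow> real) \<Rightarrow> real" where
  "L2_norm_0_pi v = sqrt (1 / pi * (\<integral>x. \<bar>v x\<bar>\<^sup>2 \<partial>lebesgue_on {0..pi}))"

definition L2_0_pi :: "(real \<Rightarrow> complex) \<Rightarrow> bool" where
  "L2_0_pi f \<longleftrightarrow> f \<in> borel_measurable (lebesgue_on {0..pi}) \<and>
     integrable (lebesgue_on {0..pi}) (\<lambda>x. (cmod (f x))\<^sup>2)"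

text \<open>Membership of y in the Sobolev space of order 2 on the interval from 0 to pi, with second
  derivative w: y is represented by its continuously differentiable version, whose derivative p
  is absolutely continuous with square-integrable derivative w (determined up to null sets).\<close>

definition has_L2_second_deriv :: "(real \<Rightarrow> complex) \<Rightarrow> (real \<Rightarrow> complex) \<Rightarrow> bool" where
  "has_L2_second_deriv y w \<longleftrightarrow> L2_0_pi w \<and>
     (\<exists>p. (\<forall>x\<in>{0..pi}. (y has_vector_derivative p x) (at x within {0..pi})) \<and>
          (\<forall>x\<in>{0..pi}. p x = p 0 + (\<integral>t. w t \<partial>lebesgue_on {0..x})))"

text \<open>The graph of the operator with Dirichlet boundary conditions: y belongs to its domain and
  it maps y to f, the latter being an equality in the space of square-integrable functions.\<close>

definition dirichlet_operator ::
  "(real \<Rightarrow> real) \<Rightarrow> complex \<Rightarrow> (real \<Rightarrow> complex) \<Rightarrow> (real \<Rightarrow> complex) \<Rightarrow> bool" where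
  "dirichlet_operator v z y f \<longleftrightarrow> y 0 = 0 \<and> y pi = 0 \<and>
     (\<exists>w. has_L2_second_deriv y w \<and>
       (AE x in lebesgue_on {0..pi}. - w x + z * complex_of_real (v x) * y x = f x))"

text \<open>The representative y is continuous, so being nonzero at one point means being nonzero
  modulo null sets.\<close>

definition dirichlet_eigenvalue :: "(real \<Rightarrow> real) \<Rightarrow> complex \<Rightarrow> complex \<Rightarrow> bool" where
  "dirichlet_eigenvalue v z \<mu> \<longleftrightarrow>
     (\<exists>y. (\<exists>x\<in>{0..pi}. y x \<noteq> 0) \<and> dirichlet_operator v z y (\<lambda>x. \<mu> * y x))"

text \<open>Only continuity at 0 is demanded of a branch of the eigenvalue through
  \<open>n\<^sup>2\<close>; analyticity is left to be proved. Values away from 0 are irrelevant.\<close>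

definition eigenvalue_branch :: "(real \<Rightarrow> real) \<Rightarrow> nat \<Rightarrow> (complex \<Rightarrow> complex) \<Rightarrow> bool" where
  "eigenvalue_branch v n E \<longleftrightarrow> E 0 = (of_nat n)\<^sup>2 \<and> isCont E 0 \<and>
     (\<forall>\<^sub>F z in nhds 0. dirichlet_eigenvalue v z (E z))"

end

(*
  The Dirichlet solution s(x; z, \<mu>) of y'' = (z v - \<mu>) y is given by a Volterra series whose terms
  are polynomials in (z, \<mu>), so \<mu> is an eigenvalue of L(z) iff D(z, \<mu>) = s(pi; z, \<mu>) vanishes, and D
  is holomorphic along every holomorphic curve. Since n^2 is a simple zero of D(0, .), a contraction
  argument yields a unique analytic branch E.

  Along the branch, D(z, E(z)) = 0 persists on the whole disc of convergence by the identity theorem.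
  There self-adjointness of the kinetic term gives |Im E(z)| <= sqrt 2 \<sigma> |z|, and the second Taylor
  coefficient e2 therefore satisfies |e2| R <= 2 sqrt 2 \<sigma>.

  On the other hand, comparing sine coefficients of the eigenfunction gives second-order perturbation
  theory: 8 e2 is the sum over k of (a_k / k) ((a_k - a_|n-k|) / (n - k) - (a_k - a_(n+k)) / (n + k)).
  The diagonal part is about 2 |v|^2 / n^2 and k a_k \<rightarrow> 0 makes the rest o(1/n^2), so that
  e2 >= |v|^2 / (8 n^2) for large n.
*)
theory Submission
  imports Defs
begin

section \<open>The Dirichlet solution as a Volterra series\<close>

text \<open>Far from z = 0 one no longer knows which eigenvalue the continued branch follows, so no
  bound on |E(z)| is at hand; what holds for every eigenvalue of L(z) is a bound on the imaginary
  part. It suffices, because Im E on a circle determines every Taylor coefficient of positive order.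
  As the bound grows linearly in |z| while the second coefficient carries r^2, one factor r
  survives: the second coefficient is the lowest one that limits the radius. The operator enters
  only through \<open>sol\<close>: an equation \<open>sol (pencil v z \<mu>) pi = 0\<close> replaces
  spectral theory and is something that analytic continuation preserves. In the lower bound the
  danger lies in the products a_k a_(n-k), which carry the weight n^2 / (k (n - k)). One of k and n
  - k is at least n/2, so the decay of k a_k makes one factor small, and absolute summability pays
  for the other. The estimates would give 8 sqrt 2 + o(1) in place of 32 sqrt 2: one factor 2 is
  spent on absorbing the errors, another is left over.\<close>

text \<open>Terms of the series for \<open>y'\<close>, where \<open>y'' = q y\<close>, \<open>y 0 = 0\<close>, \<open>y' 0 = 1\<close>.\<close>

primrec volterra :: "(real \<Rightarrow> complex) \<Rightarrow> nat \<Rightarrow> real \<Rightarrow> complex" where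
  "volterra q 0 = (\<lambda>x. 1)"
| "volterra q (Suc k) = (\<lambda>x. integral {0..x} (\<lambda>t. q t * integral {0..t} (volterra q k)))"

definition sol_slope :: "(real \<Rightarrow> complex) \<Rightarrow> real \<Rightarrow> complex" where
  "sol_slope q x = (\<Sum>k. volterra q k x)"

text \<open>The series is built for y', and y is its primitive: one relation of the first-order
  system then holds by construction, and the other is the integral equation
  \<open>sol_slope_eq\<close>.\<close>

definition sol :: "(real \<Rightarrow> complex) \<Rightarrow> real \<Rightarrow> complex" where
  "sol q x = integral {0..x} (sol_slope q)"

lemma continuous_on_primitive:
  fixes f :: "real \<Rightarrow> complex"
  assumes "continuous_on {0..a} f"
  shows "continuous_on {0..a} (\<lambda>x. integral {0..x} f)"
  using indefinite_integral_continuous_1[OF integrable_continuous_real[OF assms]] .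

lemma continuous_on_volterra:
  assumes "continuous_on {0..a} q"
  shows "continuous_on {0..a} (volterra q k)"
  by (induction k) (auto intro!: continuous_on_primitive continuous_intros assms)

text \<open>Keeping the power under the integral produces the factor 1 / (k + 1), hence the
  factorial in \<open>norm_volterra_le\<close>.\<close>

lemma norm_primitive_power_le:
  fixes f :: "real \<Rightarrow> complex"
  assumes f: "continuous_on {0..x} f" and x: "0 \<le> x"
    and le: "\<And>t. t \<in> {0..x} \<Longrightarrow> norm (f t) \<le> B * t ^ k"
  shows "norm (integral {0..x} f) \<le> B * x ^ Suc k / real (Suc k)"
proof -
  have "((\<lambda>t. B * t ^ k) has_integral (B * x ^ Suc k / real (Suc k) - B * 0 ^ Suc k / real (Suc k))) {0..x}"
  proof (rule fundamental_theorem_of_calculus[OF x])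
    fix t :: real
    have "((\<lambda>t. B * t ^ Suc k / real (Suc k)) has_real_derivative
        B * (real (Suc k) * t ^ k) / real (Suc k)) (at t within {0..x})"
      using DERIV_cdivide[OF DERIV_cmult[OF DERIV_pow[of "Suc k" t "{0..x}"]], of B "real (Suc k)"] by simp
    then show "((\<lambda>t. B * t ^ Suc k / real (Suc k)) has_vector_derivative B * t ^ k) (at t within {0..x})"
      by (simp add: has_real_derivative_iff_has_vector_derivative del: of_nat_Suc)
  qed
  moreover from this have "norm (integral {0..x} f) \<le> integral {0..x} (\<lambda>t. B * t ^ k)"
    by (intro integral_norm_bound_integral integrable_continuous_real[OF f] le)
      (auto simp: has_integral_integrable_integral)
  ultimately show ?thesis
    by (simp add: has_integral_integrable_integral)
qed

text \<open>Each recursion step integrates twice. The inner integral is bounded crudely by the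
  length of the interval; only the outer one gains 1 / (k + 1). A denominator k! in place of (2k)!
  is enough for convergence whatever M is.\<close>

lemma norm_volterra_le:
  assumes q: "continuous_on {0..a} q" "\<And>x. x \<in> {0..a} \<Longrightarrow> norm (q x) \<le> M"
    and x: "x \<in> {0..a}"
  shows "norm (volterra q k x) \<le> (M * a * x) ^ k / fact k"
  using x
proof (induction k arbitrary: x)
  case 0
  then show ?case by simp
next
  case (Suc k)
  have a: "0 \<le> a" and M: "0 \<le> M"
    using Suc.prems q(2)[of x] norm_ge_zero[of "q x"] by (auto intro: order_trans simp del: norm_ge_zero)
  have c: "continuous_on {0..t} (volterra q k)" if "t \<le> a" for t
    using continuous_on_subset[OF continuous_on_volterra[OF q(1)]] that by auto
  have 1: "norm (integral {0..t} (volterra q k)) \<le> a * (M * a * t) ^ k / fact k"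
    if t: "t \<in> {0..a}" for t
  proof -
    have "norm (integral {0..t} (volterra q k)) \<le> (M * a * t) ^ k / fact k * (t - 0)"
    proof (rule integral_bound)
      fix r assume r: "r \<in> {0..t}"
      have "norm (volterra q k r) \<le> (M * a * r) ^ k / fact k"
        using Suc.IH r t by auto
      also have "\<dots> \<le> (M * a * t) ^ k / fact k"
        using r a M by (intro divide_right_mono power_mono mult_left_mono) auto
      finally show "norm (volterra q k r) \<le> (M * a * t) ^ k / fact k" .
    qed (use t c in auto)
    also have "\<dots> \<le> (M * a * t) ^ k / fact k * a"
      using t M a by (intro mult_left_mono) auto
    finally show ?thesis by (simp add: mult_ac)
  qed
  have "norm (volterra q (Suc k) x) \<le> (M * a * (M * a) ^ k / fact k) * x ^ Suc k / real (Suc k)"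
    unfolding volterra.simps
  proof (rule norm_primitive_power_le)
    show "continuous_on {0..x} (\<lambda>t. q t * integral {0..t} (volterra q k))"
      using Suc.prems by (intro continuous_intros continuous_on_primitive c continuous_on_subset[OF q(1)]) auto
    fix t assume t: "t \<in> {0..x}"
    have "norm (q t * integral {0..t} (volterra q k)) \<le> M * (a * (M * a * t) ^ k / fact k)"
      unfolding norm_mult using t Suc.prems by (intro mult_mono q(2) 1) (auto simp: M)
    then show "norm (q t * integral {0..t} (volterra q k)) \<le> M * a * (M * a) ^ k / fact k * t ^ k"
      by (simp add: power_mult_distrib mult_ac)
  qed (use Suc.prems in auto)
  also have "\<dots> = (M * a * x) ^ Suc k / fact (Suc k)"
    by (simp add: power_mult_distrib field_simps del: of_nat_Suc)
  finally show ?case .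
qed

lemma norm_volterra_le':
  assumes q: "continuous_on {0..a} q" "\<And>x. x \<in> {0..a} \<Longrightarrow> norm (q x) \<le> M"
    and x: "x \<in> {0..a}"
  shows "norm (volterra q k x) \<le> (M * a * a) ^ k / fact k"
proof -
  have a: "0 \<le> a" and M: "0 \<le> M"
    using x q(2)[of x] norm_ge_zero[of "q x"] by (auto intro: order_trans simp del: norm_ge_zero)
  show ?thesis
    by (rule order_trans[OF norm_volterra_le[OF assms]])
      (use x a M in \<open>auto intro!: divide_right_mono power_mono mult_left_mono mult_nonneg_nonneg\<close>)
qed

lemma summable_power_fact: "summable (\<lambda>k. (c::real) ^ k / fact k)"
  using summable_exp_generic[of c] by (simp add: field_simps scaleR_conv_of_real)

lemma uniform_limit_sol_slope:
  assumes q: "continuous_on {0..a} q" "\<And>x. x \<in> {0..a} \<Longrightarrow> norm (q x) \<le> M"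
  shows "uniform_limit {0..a} (\<lambda>N x. \<Sum>k<N. volterra q k x) (sol_slope q) sequentially"
  unfolding sol_slope_def
  by (rule Weierstrass_m_test[OF norm_volterra_le'[OF q] summable_power_fact])

lemma continuous_on_bounded_Icc:
  assumes "continuous_on {0..a::real} (q :: real \<Rightarrow> complex)"
  obtains M where "\<And>x. x \<in> {0..a} \<Longrightarrow> norm (q x) \<le> M"
  using compact_imp_bounded[OF compact_continuous_image[OF assms compact_Icc]] that
  unfolding bounded_iff by blast

lemma continuous_on_sol_slope:
  assumes "continuous_on {0..a} q"
  shows "continuous_on {0..a} (sol_slope q)"
proof -
  obtain M where M: "\<And>x. x \<in> {0..a} \<Longrightarrow> norm (q x) \<le> M"
    using continuous_on_bounded_Icc[OF assms] by blast
  show ?thesis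
    by (rule uniform_limit_theorem[OF _ uniform_limit_sol_slope[OF assms M]])
      (auto intro!: always_eventually continuous_intros continuous_on_volterra assms)
qed

lemma has_vector_derivative_sol:
  assumes "continuous_on {0..a} q" "x \<in> {0..a}"
  shows "(sol q has_vector_derivative sol_slope q x) (at x within {0..a})"
  unfolding sol_def[abs_def]
  by (rule integral_has_vector_derivative[OF continuous_on_sol_slope[OF assms(1)] assms(2)])

lemma continuous_on_sol:
  assumes "continuous_on {0..a} q"
  shows "continuous_on {0..a} (sol q)"
  unfolding sol_def[abs_def] by (intro continuous_on_primitive continuous_on_sol_slope assms)

lemma sol_sums:
  assumes q: "continuous_on {0..a} q" and x: "x \<in> {0..a}"
  shows "(\<lambda>k. integral {0..x} (volterra q k)) sums sol q x"
proof -
  obtain M where M: "\<And>x. x \<in> {0..a} \<Longrightarrow> norm (q x) \<le> M"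
    using continuous_on_bounded_Icc[OF q] by blast
  have c: "continuous_on {0..x} (volterra q k)" for k
    using continuous_on_subset[OF continuous_on_volterra[OF q]] x by auto
  obtain I J where IJ: "\<And>n. ((\<lambda>y. \<Sum>k<n. volterra q k y) has_integral I n) {0..x}"
    "(sol_slope q has_integral J) {0..x}" "I \<longlonglongrightarrow> J"
    by (rule uniform_limit_integral[OF uniform_limit_on_subset[OF uniform_limit_sol_slope[OF q M]], where a=0 and b=x])
      (use x in \<open>auto intro!: continuous_intros c\<close>)
  have "I n = (\<Sum>k<n. integral {0..x} (volterra q k))" for n
    using integral_unique[OF IJ(1)[of n]]
    by (subst (asm) integral_sum) (auto intro!: integrable_continuous_real c)
  then have "I = (\<lambda>n. \<Sum>k<n. integral {0..x} (volterra q k))" by blast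
  with IJ(2,3) show ?thesis
    unfolding sums_def sol_def by (simp add: integral_unique)
qed

text \<open>Sum the recursion over k. The inner primitives add up uniformly to \<open>sol q\<close>,
  so sum and outer integral may be exchanged; the term of index 0, which the recursion does not
  produce, supplies the 1.\<close>

lemma sol_slope_eq:
  assumes q: "continuous_on {0..a} q" and x: "x \<in> {0..a}"
  shows "sol_slope q x = 1 + integral {0..x} (\<lambda>t. q t * sol q t)"
proof -
  obtain M where M: "\<And>x. x \<in> {0..a} \<Longrightarrow> norm (q x) \<le> M"
    using continuous_on_bounded_Icc[OF q] by blast
  have 0: "{0..x} \<subseteq> {0..a}" using x by auto
  have c: "continuous_on {0..x} (volterra q k)" for k
    using continuous_on_subset[OF continuous_on_volterra[OF q]] x by auto
  have cq: "continuous_on {0..x} q"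
    using continuous_on_subset[OF q 0] .
  have "norm (integral {0..t} (volterra q k)) \<le> (M * a * a) ^ k / fact k * a"
    if t: "t \<in> {0..x}" for t k
  proof -
    have "norm (integral {0..t} (volterra q k)) \<le> (M * a * a) ^ k / fact k * (t - 0)"
      using t x by (intro integral_bound norm_volterra_le'[OF q M] continuous_on_subset[OF c]) auto
    also have "\<dots> \<le> (M * a * a) ^ k / fact k * a"
      using t x norm_ge_zero[of "q 0"] M[of 0]
      by (intro mult_left_mono divide_nonneg_nonneg zero_le_power mult_nonneg_nonneg)
        (auto simp del: norm_ge_zero)
    finally show ?thesis .
  qed
  then have "uniform_limit {0..x} (\<lambda>N t. \<Sum>k<N. integral {0..t} (volterra q k))
     (\<lambda>t. \<Sum>k. integral {0..t} (volterra q k)) sequentially"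
    by (rule Weierstrass_m_test[OF _ summable_mult2[OF summable_power_fact]])
  then have u: "uniform_limit {0..x} (\<lambda>N t. \<Sum>k<N. integral {0..t} (volterra q k)) (sol q) sequentially"
    by (rule uniform_limit_cong'[THEN iffD1, rotated -1])
      (use sol_sums[OF q] x in \<open>auto simp: sums_iff\<close>)
  have "bounded (q ` {0..x})" "bounded (sol q ` {0..x})"
    by (auto intro!: compact_imp_bounded compact_continuous_image cq
        continuous_on_subset[OF continuous_on_sol[OF q] 0])
  then have u': "uniform_limit {0..x} (\<lambda>N t. q t * (\<Sum>k<N. integral {0..t} (volterra q k)))
     (\<lambda>t. q t * sol q t) sequentially"
    by (intro uniform_lim_mult u uniform_limit_const)
  obtain I J where IJ: "\<And>n. ((\<lambda>t. q t * (\<Sum>k<n. integral {0..t} (volterra q k))) has_integral I n) {0..x}"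
    "((\<lambda>t. q t * sol q t) has_integral J) {0..x}" "I \<longlonglongrightarrow> J"
    by (rule uniform_limit_integral[OF u'])
      (auto intro!: continuous_intros continuous_on_primitive c cq)
  have "I = (\<lambda>n. \<Sum>k<n. volterra q (Suc k) x)"
  proof
    show "I n = (\<Sum>k<n. volterra q (Suc k) x)" for n
    using integral_unique[OF IJ(1)[of n]]
    by (subst (asm) sum_distrib_left, subst (asm) integral_sum)
      (auto intro!: integrable_continuous_real continuous_intros continuous_on_primitive c cq)
  qed
  then have "(\<lambda>k. volterra q (Suc k) x) sums J"
    using IJ(3) by (simp add: sums_def)
  then have "(\<lambda>k. volterra q k x) sums (J + volterra q 0 x)"
    by (subst (asm) sums_Suc_iff) simp
  then show ?thesis
    using integral_unique[OF IJ(2)] by (simp add: sol_slope_def sums_iff)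
qed

lemma has_vector_derivative_sol_slope:
  assumes q: "continuous_on {0..a} q" and x: "x \<in> {0..a}"
  shows "(sol_slope q has_vector_derivative q x * sol q x) (at x within {0..a})"
proof -
  have "((\<lambda>x. 1 + integral {0..x} (\<lambda>t. q t * sol q t)) has_vector_derivative (0 + q x * sol q x)) (at x within {0..a})"
    by (intro has_vector_derivative_add has_vector_derivative_const integral_has_vector_derivative
      continuous_intros q continuous_on_sol x)
  then show ?thesis
    using has_vector_derivative_transform[OF x, of "sol_slope q" "\<lambda>x. 1 + integral {0..x} (\<lambda>t. q t * sol q t)"]
      sol_slope_eq[OF q] by simp
qed

lemma sol_0 [simp]: "sol q 0 = 0"
  by (simp add: sol_def)

lemma sol_slope_0 [simp]: "sol_slope q 0 = 1"
proof -
  have "volterra q k 0 = (if k = 0 then 1 else 0)" for k by (cases k) auto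
  then show ?thesis
    unfolding sol_slope_def using sums_unique[OF sums_single[of 0 "\<lambda>_. 1::complex"]] by simp
qed

section \<open>Uniqueness for the initial value problem\<close>

lemma nonincreasing_Icc:
  fixes h h' :: "real \<Rightarrow> real"
  assumes "\<And>t. t \<in> {a..b} \<Longrightarrow> (h has_real_derivative h' t) (at t within {a..b})"
    and "\<And>t. t \<in> {a..b} \<Longrightarrow> h' t \<le> 0"
    and "a \<le> s" "s \<le> t" "t \<le> b"
  shows "h t \<le> h s"
proof (rule DERIV_nonpos_imp_decreasing_open[OF assms(4)])
  show "\<exists>y. DERIV h x :> y \<and> y \<le> 0" if "s < x" "x < t" for x
    using assms(1,2)[of x] that assms(3-5) by (auto simp: at_within_Icc_at)
  have "continuous_on {a..b} h"
    using assms(1) by (meson DERIV_continuous continuous_on_eq_continuous_within)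
  then show "continuous_on {s..t} h"
    by (rule continuous_on_subset) (use assms in auto)
qed

text \<open>Energy estimate: \<open>|y|\<^sup>2 + |p|\<^sup>2\<close> satisfies a Gronwall inequality.\<close>

lemma second_order_ode_zero:
  fixes y p q :: "real \<Rightarrow> complex"
  assumes q: "\<And>x. x \<in> {0..a} \<Longrightarrow> norm (q x) \<le> M"
    and y: "\<And>x. x \<in> {0..a} \<Longrightarrow> (y has_vector_derivative p x) (at x within {0..a})"
    and p: "\<And>x. x \<in> {0..a} \<Longrightarrow> (p has_vector_derivative q x * y x) (at x within {0..a})"
    and "y 0 = 0" "p 0 = 0" and x: "x \<in> {0..a}"
  shows "y x = 0"
proof -
  \<comment> \<open>The rate 1 + M comes from the derivative of the energy, which is at most 2 (1 +
    M) |y| |p|, together with 2 |y| |p| <= |y|^2 + |p|^2. So h decreases from 0, yet it is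
    nonnegative.\<close>
  define h where "h t = (y t \<bullet> y t + p t \<bullet> p t) * exp (- (1 + M) * t)" for t
  have M: "0 \<le> M" using q[OF x] norm_ge_zero[of "q x"] by linarith
  have exp_combine_le: "A * e + G * (e * (- (1 + M))) \<le> 0" if "A \<le> (1 + M) * G" "0 \<le> e" for A G e :: real
    using mult_right_mono[OF that] by (simp add: algebra_simps)
  have "\<exists>d. (h has_real_derivative d) (at t within {0..a}) \<and> d \<le> 0" if t: "t \<in> {0..a}" for t
  proof -
    have "((\<lambda>t. y t \<bullet> y t) has_vector_derivative (y t \<bullet> p t + p t \<bullet> y t)) (at t within {0..a})"
      "((\<lambda>t. p t \<bullet> p t) has_vector_derivative (p t \<bullet> (q t * y t) + (q t * y t) \<bullet> p t)) (at t within {0..a})"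
      using y[OF t] p[OF t] by (auto intro!: bounded_bilinear.has_vector_derivative[OF bounded_bilinear_inner])
    then have "(h has_real_derivative
        (y t \<bullet> p t + p t \<bullet> y t + (p t \<bullet> (q t * y t) + (q t * y t) \<bullet> p t)) * exp (- (1 + M) * t)
         + (y t \<bullet> y t + p t \<bullet> p t) * (exp (- (1 + M) * t) * (- (1 + M)))) (at t within {0..a})"
      unfolding h_def[abs_def] has_real_derivative_iff_has_vector_derivative[symmetric]
      by (auto intro!: derivative_eq_intros)
    moreover have "y t \<bullet> p t + p t \<bullet> y t + (p t \<bullet> (q t * y t) + (q t * y t) \<bullet> p t)
        \<le> (1 + M) * (y t \<bullet> y t + p t \<bullet> p t)"
    proof -
      have "y t \<bullet> p t \<le> norm (y t) * norm (p t)" by (rule norm_cauchy_schwarz)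
      moreover have "(q t * y t) \<bullet> p t \<le> M * (norm (y t) * norm (p t))"
      proof -
        have "(q t * y t) \<bullet> p t \<le> norm (q t) * norm (y t) * norm (p t)"
          using norm_cauchy_schwarz[of "q t * y t" "p t"] by (simp add: norm_mult)
        also have "\<dots> \<le> M * norm (y t) * norm (p t)"
          by (intro mult_right_mono q t) auto
        finally show ?thesis by (simp add: mult_ac)
      qed
      moreover have "2 * (norm (y t) * norm (p t)) \<le> y t \<bullet> y t + p t \<bullet> p t"
        using sum_squares_bound[of "norm (y t)" "norm (p t)"]
        by (simp add: power2_norm_eq_inner mult_ac)
      then have "(1 + M) * (2 * (norm (y t) * norm (p t))) \<le> (1 + M) * (y t \<bullet> y t + p t \<bullet> p t)"
        using M by (intro mult_left_mono) auto
      ultimately show ?thesis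
        by (simp add: algebra_simps inner_commute)
    qed
    then have "(y t \<bullet> p t + p t \<bullet> y t + (p t \<bullet> (q t * y t) + (q t * y t) \<bullet> p t)) * exp (- (1 + M) * t)
         + (y t \<bullet> y t + p t \<bullet> p t) * (exp (- (1 + M) * t) * (- (1 + M))) \<le> 0"
      by (intro exp_combine_le) auto
    ultimately show ?thesis by blast
  qed
  then obtain h' where h': "\<And>t. t \<in> {0..a} \<Longrightarrow> (h has_real_derivative h' t) (at t within {0..a})"
    "\<And>t. t \<in> {0..a} \<Longrightarrow> h' t \<le> 0" by metis
  have "h x \<le> h 0"
    by (rule nonincreasing_Icc[OF h']) (use x in auto)
  moreover have "h 0 = 0" using assms(4,5) by (simp add: h_def)
  moreover have "0 \<le> y x \<bullet> y x" "0 \<le> p x \<bullet> p x" by auto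
  ultimately have "y x \<bullet> y x + p x \<bullet> p x \<le> 0"
    by (simp add: h_def mult_le_0_iff)
  then have "y x \<bullet> y x = 0" using \<open>0 \<le> y x \<bullet> y x\<close> \<open>0 \<le> p x \<bullet> p x\<close> by linarith
  then show ?thesis by simp
qed

section \<open>Dependence on the parameters\<close>

text \<open>The coefficient q for which y'' = q y is the eigenvalue equation - y'' + z v y = \<mu>
  y.\<close>

definition pencil :: "(real \<Rightarrow> real) \<Rightarrow> complex \<Rightarrow> complex \<Rightarrow> real \<Rightarrow> complex" where
  "pencil v z \<mu> x = z * complex_of_real (v x) - \<mu>"

lemma continuous_on_pencil:
  "continuous_on S v \<Longrightarrow> continuous_on S (pencil v z \<mu>)"
  unfolding pencil_def[abs_def] by (intro continuous_intros)

text \<open>\<open>pencil\<close> is linear in (z, \<mu>), so the k-th term is a homogeneous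
  polynomial of degree k whose coefficients depend on x alone. Holomorphy in the parameters and
  joint continuity then both follow from uniform convergence, without differentiating under an
  integral.\<close>

lemma volterra_pencil_polynomial:
  assumes v: "continuous_on {0..a} v"
  shows "\<exists>c. (\<forall>j. continuous_on {0..a} (c j)) \<and>
    (\<forall>z \<mu>. \<forall>x\<in>{0..a}. volterra (pencil v z \<mu>) k x = (\<Sum>j\<le>k. z ^ j * \<mu> ^ (k - j) * c j x))"
proof (induction k)
  case 0
  show ?case by (rule exI[of _ "\<lambda>_ _. 1"]) auto
next
  case (Suc k)
  then obtain c where c: "\<And>j. continuous_on {0..a} (c j)"
    and eq: "\<And>z \<mu> x. x \<in> {0..a} \<Longrightarrow>
      volterra (pencil v z \<mu>) k x = (\<Sum>j\<le>k. z ^ j * \<mu> ^ (k - j) * c j x)"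
    by blast
  define C where "C j t = integral {0..t} (c j)" for j t
  have C: "continuous_on {0..a} (C j)" for j
    unfolding C_def[abs_def] by (intro continuous_on_primitive c)
  define A where "A j x = integral {0..x} (\<lambda>t. complex_of_real (v t) * C j t)" for j x
  define B where "B j x = integral {0..x} (\<lambda>t. - C j t)" for j x
  have cAB: "continuous_on {0..a} (A j)" "continuous_on {0..a} (B j)" for j
    unfolding A_def[abs_def] B_def[abs_def]
    by (auto intro!: continuous_on_primitive continuous_intros C v)
  \<comment> \<open>The factor z v raises the power of z by one and so shifts the index
    (\<open>A\<close>); the factor - \<mu> keeps it (\<open>B\<close>), which is why
    \<open>B\<close> is absent from the top index k + 1.\<close>
  define c' where "c' j x = (case j of 0 \<Rightarrow> 0 | Suc i \<Rightarrow> A i x) + (if j \<le> k then B j x else 0)" for j x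
  have "continuous_on {0..a} (c' j)" for j
    unfolding c'_def[abs_def]
    by (cases j; cases "j \<le> k") (auto intro!: continuous_intros cAB)
  moreover have "volterra (pencil v z \<mu>) (Suc k) x = (\<Sum>j\<le>Suc k. z ^ j * \<mu> ^ (Suc k - j) * c' j x)"
    if x: "x \<in> {0..a}" for z \<mu> x
  proof -
    have i1: "integral {0..t} (volterra (pencil v z \<mu>) k) = (\<Sum>j\<le>k. z ^ j * \<mu> ^ (k - j) * C j t)"
      if t: "t \<in> {0..a}" for t
    proof -
      have "integral {0..t} (volterra (pencil v z \<mu>) k) =
          integral {0..t} (\<lambda>x. \<Sum>j\<le>k. z ^ j * \<mu> ^ (k - j) * c j x)"
        using t by (intro integral_cong eq) auto
      also have "\<dots> = (\<Sum>j\<le>k. z ^ j * \<mu> ^ (k - j) * C j t)"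
        unfolding C_def using t
        by (subst integral_sum) (auto intro!: integrable_continuous_real continuous_intros continuous_on_subset[OF c])
      finally show ?thesis .
    qed
    have ii: "(\<lambda>t. complex_of_real (v t) * C j t) integrable_on {0..x}" "C j integrable_on {0..x}" for j
      using x by (auto intro!: integrable_continuous_real continuous_intros continuous_on_subset[OF C] continuous_on_subset[OF v])
    have "volterra (pencil v z \<mu>) (Suc k) x =
        integral {0..x} (\<lambda>t. pencil v z \<mu> t * (\<Sum>j\<le>k. z ^ j * \<mu> ^ (k - j) * C j t))"
      using x by (auto intro!: integral_cong simp: i1)
    also have "\<dots> = integral {0..x} (\<lambda>t.
        (\<Sum>j\<le>k. z ^ Suc j * \<mu> ^ (k - j) * (complex_of_real (v t) * C j t)) +
        (\<Sum>j\<le>k. z ^ j * \<mu> ^ (Suc k - j) * - C j t))"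
      unfolding sum_distrib_left sum.distrib[symmetric]
      by (intro integral_cong sum.cong refl) (auto simp: pencil_def algebra_simps Suc_diff_le)
    also have "\<dots> = (\<Sum>j\<le>k. z ^ Suc j * \<mu> ^ (k - j) * A j x) + (\<Sum>j\<le>k. z ^ j * \<mu> ^ (Suc k - j) * B j x)"
      unfolding A_def B_def
      by (intro integral_unique has_integral_add has_integral_sum has_integral_mult_right
          integrable_integral integrable_neg ii) auto
    also have "(\<Sum>j\<le>k. z ^ Suc j * \<mu> ^ (k - j) * A j x) =
        (\<Sum>j\<le>Suc k. z ^ j * \<mu> ^ (Suc k - j) * (case j of 0 \<Rightarrow> 0 | Suc i \<Rightarrow> A i x))"
      by (subst sum.atMost_Suc_shift) simp
    also have "(\<Sum>j\<le>k. z ^ j * \<mu> ^ (Suc k - j) * B j x) =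
        (\<Sum>j\<le>Suc k. z ^ j * \<mu> ^ (Suc k - j) * (if j \<le> k then B j x else 0))"
      by simp
    finally show ?thesis
      by (simp add: c'_def distrib_left sum.distrib del: sum.atMost_Suc)
  qed
  ultimately show ?case by blast
qed

lemma integral_volterra_pencil_polynomial:
  assumes v: "continuous_on {0..a} v"
  shows "\<exists>c. (\<forall>j. continuous_on {0..a} (c j)) \<and>
    (\<forall>z \<mu>. \<forall>x\<in>{0..a}. integral {0..x} (volterra (pencil v z \<mu>) k) =
       (\<Sum>j\<le>k. z ^ j * \<mu> ^ (k - j) * c j x))"
proof -
  obtain c where c: "\<And>j. continuous_on {0..a} (c j)"
    and eq: "\<And>z \<mu> x. x \<in> {0..a} \<Longrightarrow>
      volterra (pencil v z \<mu>) k x = (\<Sum>j\<le>k. z ^ j * \<mu> ^ (k - j) * c j x)"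
    using volterra_pencil_polynomial[OF v] by blast
  have "integral {0..t} (volterra (pencil v z \<mu>) k) =
     (\<Sum>j\<le>k. z ^ j * \<mu> ^ (k - j) * integral {0..t} (c j))"
    if t: "t \<in> {0..a}" for t z \<mu>
  proof -
    have "integral {0..t} (volterra (pencil v z \<mu>) k) =
        integral {0..t} (\<lambda>x. \<Sum>j\<le>k. z ^ j * \<mu> ^ (k - j) * c j x)"
      using t by (intro integral_cong eq) auto
    also have "\<dots> = (\<Sum>j\<le>k. z ^ j * \<mu> ^ (k - j) * integral {0..t} (c j))"
      using t
      by (subst integral_sum) (auto intro!: integrable_continuous_real continuous_intros continuous_on_subset[OF c])
    finally show ?thesis .
  qed
  moreover have "continuous_on {0..a} (\<lambda>t. integral {0..t} (c j))" for j
    by (intro continuous_on_primitive c)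
  ultimately show ?thesis
    by (intro exI[of _ "\<lambda>j t. integral {0..t} (c j)"]) blast
qed

text \<open>The index set T is left arbitrary so that one estimate serves both a curve of parameters
  at fixed x and the triple (z, \<mu>, x) itself.\<close>

lemma uniform_limit_sol_pencil:
  assumes v: "continuous_on {0..a} v" "\<And>x. x \<in> {0..a} \<Longrightarrow> \<bar>v x\<bar> \<le> V" "0 \<le> a"
    and T: "\<And>p. p \<in> T \<Longrightarrow> norm (f p) \<le> r \<and> norm (g p) \<le> r \<and> h p \<in> {0..a}"
  shows "uniform_limit T (\<lambda>N p. \<Sum>k<N. integral {0..h p} (volterra (pencil v (f p) (g p)) k))
           (\<lambda>p. sol (pencil v (f p) (g p)) (h p)) sequentially"
proof -
  define M where "M = r * V + r"
  have le: "norm (integral {0..h p} (volterra (pencil v (f p) (g p)) k)) \<le> (M * a * a) ^ k / fact k * a"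
    if p: "p \<in> T" for k p
  proof -
    let ?q = "pencil v (f p) (g p)"
    have q: "continuous_on {0..a} ?q"
      by (rule continuous_on_pencil[OF v(1)])
    have M: "norm (?q x) \<le> M" if "x \<in> {0..a}" for x
    proof -
      have "norm (?q x) \<le> norm (f p) * \<bar>v x\<bar> + norm (g p)"
        unfolding pencil_def using norm_triangle_ineq4[of "f p * complex_of_real (v x)" "g p"]
        by (simp add: norm_mult)
      also have "\<dots> \<le> M"
        unfolding M_def using T[OF p] v(2)[OF that] order_trans[OF norm_ge_zero, of "f p" r]
        by (intro add_mono mult_mono) auto
      finally show ?thesis .
    qed
    have M0: "0 \<le> M" using order_trans[OF norm_ge_zero M[of 0]] v(3) by simp
    have "norm (integral {0..h p} (volterra ?q k)) \<le> (M * a * a) ^ k / fact k * (h p - 0)"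
      using T[OF p]
      by (intro integral_bound norm_volterra_le'[OF q M] continuous_on_subset[OF continuous_on_volterra[OF q]]) auto
    also have "\<dots> \<le> (M * a * a) ^ k / fact k * a"
      using T[OF p] M0 v(3)
      by (intro mult_left_mono divide_nonneg_nonneg zero_le_power mult_nonneg_nonneg) auto
    finally show ?thesis .
  qed
  have "uniform_limit T (\<lambda>N p. \<Sum>k<N. integral {0..h p} (volterra (pencil v (f p) (g p)) k))
           (\<lambda>p. \<Sum>k. integral {0..h p} (volterra (pencil v (f p) (g p)) k)) sequentially"
    by (rule Weierstrass_m_test[OF le summable_mult2[OF summable_power_fact]])
  then show ?thesis
    by (rule uniform_limit_cong'[THEN iffD1, rotated -1])
      (use sol_sums[OF continuous_on_pencil[OF v(1)]] T in \<open>auto simp: sums_iff\<close>)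
qed

lemma continuous_on_compact_bound:
  assumes "continuous_on {0..a::real} (v :: real \<Rightarrow> real)"
  obtains V where "\<And>x. x \<in> {0..a} \<Longrightarrow> \<bar>v x\<bar> \<le> V"
  using compact_imp_bounded[OF compact_continuous_image[OF assms compact_Icc]] that
  unfolding bounded_iff real_norm_def by blast

text \<open>Stating holomorphy along a curve (f, g) keeps the theory of two complex variables out.
  The curves used later are constant z, the graph of a function of z, and the graph of the summed
  Taylor series on its disc.\<close>

lemma holomorphic_on_sol_pencil:
  assumes v: "continuous_on {0..a} v" and x: "x \<in> {0..a}"
    and A: "open A" "f holomorphic_on A" "g holomorphic_on A"
  shows "(\<lambda>w. sol (pencil v (f w) (g w)) x) holomorphic_on A"
proof (rule holomorphic_uniform_sequence[OF A(1)])
  fix N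
  have "(\<lambda>w. integral {0..x} (volterra (pencil v (f w) (g w)) k)) holomorphic_on A" for k
  proof -
    obtain c where c: "\<And>z \<mu> x. x \<in> {0..a} \<Longrightarrow> integral {0..x} (volterra (pencil v z \<mu>) k) =
       (\<Sum>j\<le>k. z ^ j * \<mu> ^ (k - j) * c j x)"
      using integral_volterra_pencil_polynomial[OF v] by blast
    show ?thesis unfolding c[OF x] by (intro holomorphic_intros A)
  qed
  then show "(\<lambda>w. \<Sum>k<N. integral {0..x} (volterra (pencil v (f w) (g w)) k)) holomorphic_on A"
    by (intro holomorphic_intros)
next
  fix w assume w: "w \<in> A"
  obtain d where d: "d > 0" "cball w d \<subseteq> A" using w A(1) open_contains_cball by blast
  have "bounded (f ` cball w d)" "bounded (g ` cball w d)"
    by (intro compact_imp_bounded compact_continuous_image compact_cball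
        holomorphic_on_imp_continuous_on holomorphic_on_subset[OF _ d(2)] A)+
  then obtain r1 r2 where r: "\<And>p. p \<in> cball w d \<Longrightarrow> norm (f p) \<le> r1"
      "\<And>p. p \<in> cball w d \<Longrightarrow> norm (g p) \<le> r2"
    unfolding bounded_iff by blast
  obtain V where V: "\<And>x. x \<in> {0..a} \<Longrightarrow> \<bar>v x\<bar> \<le> V"
    using continuous_on_compact_bound[OF v] by blast
  have "uniform_limit (cball w d) (\<lambda>N p. \<Sum>k<N. integral {0..x} (volterra (pencil v (f p) (g p)) k))
           (\<lambda>p. sol (pencil v (f p) (g p)) x) sequentially"
    by (rule uniform_limit_sol_pencil[where r="max r1 r2", OF v V])
      (use x r in \<open>auto simp: le_max_iff_disj\<close>)
  with d show "\<exists>d>0. cball w d \<subseteq> A \<and>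
      uniform_limit (cball w d) (\<lambda>N p. \<Sum>k<N. integral {0..x} (volterra (pencil v (f p) (g p)) k))
           (\<lambda>p. sol (pencil v (f p) (g p)) x) sequentially" by blast
qed

lemma continuous_on_sol_pencil:
  assumes v: "continuous_on {0..a} v" and "0 \<le> a"
  shows "continuous_on (UNIV \<times> UNIV \<times> {0..a}) (\<lambda>(z, \<mu>, x). sol (pencil v z \<mu>) x)"
proof -
  obtain V where V: "\<And>x. x \<in> {0..a} \<Longrightarrow> \<bar>v x\<bar> \<le> V"
    using continuous_on_compact_bound[OF v] by blast
  have *: "continuous_on (ball 0 r \<times> ball 0 r \<times> {0..a}) (\<lambda>(z, \<mu>, x). sol (pencil v z \<mu>) x)" for r
  proof (rule uniform_limit_theorem)
    let ?T = "ball (0::complex) r \<times> ball (0::complex) r \<times> {0..a}"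
    let ?P = "\<lambda>N (z, \<mu>, x). \<Sum>k<N. integral {0..x} (volterra (pencil v z \<mu>) k)"
    show "uniform_limit ?T ?P (\<lambda>(z, \<mu>, x). sol (pencil v z \<mu>) x) sequentially"
      using uniform_limit_sol_pencil[where T="?T" and r=r and f=fst and g="fst \<circ> snd" and h="snd \<circ> snd", OF v V assms(2)]
      by (auto simp: case_prod_beta')
    have "continuous_on ?T (\<lambda>(z, \<mu>, x). integral {0..x} (volterra (pencil v z \<mu>) k))" for k
    proof -
      obtain c where cc: "\<And>j. continuous_on {0..a} (c j)" and
        c: "\<And>z \<mu> x. x \<in> {0..a} \<Longrightarrow> integral {0..x} (volterra (pencil v z \<mu>) k) =
         (\<Sum>j\<le>k. z ^ j * \<mu> ^ (k - j) * c j x)"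
        using integral_volterra_pencil_polynomial[OF v] by blast
      have "continuous_on ?T (\<lambda>p. \<Sum>j\<le>k. fst p ^ j * fst (snd p) ^ (k - j) * c j (snd (snd p)))"
        by (intro continuous_intros continuous_on_compose2[OF cc]) auto
      then show ?thesis
        by (rule continuous_on_eq) (auto simp: c)
    qed
    then show "\<forall>\<^sub>F N in sequentially. continuous_on ?T (?P N)"
      by (auto intro!: always_eventually continuous_on_sum simp: case_prod_beta')
  qed auto
  have "continuous (at p within (UNIV \<times> UNIV \<times> {0..a})) (\<lambda>(z, \<mu>, x). sol (pencil v z \<mu>) x)"
    if p: "p \<in> UNIV \<times> UNIV \<times> {0..a}" for p
  proof -
    \<comment> \<open>Convergence is uniform only for bounded parameters, so each point is placed in
      a product of balls on which continuity is already known.\<close>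
    define r where "r = norm (fst p) + norm (fst (snd p)) + 1"
    let ?U = "ball (0::complex) r \<times> ball (0::complex) r \<times> (UNIV :: real set)"
    have p': "p \<in> ?U"
      using p norm_ge_zero[of "fst p"] norm_ge_zero[of "fst (snd p)"]
      by (auto simp: r_def mem_Times_iff simp del: norm_ge_zero)
    have "at p within (UNIV \<times> UNIV \<times> {0..a}) = at p within (ball 0 r \<times> ball 0 r \<times> {0..a})"
      by (rule at_within_nhd[OF p']) (auto intro!: open_Times)
    moreover have "p \<in> ball 0 r \<times> ball 0 r \<times> {0..a}"
      using p p' by (auto simp: mem_Times_iff)
    ultimately show ?thesis
      using *[of r] unfolding continuous_on_eq_continuous_within by metis
  qed
  then show ?thesis by (simp add: continuous_on_eq_continuous_within)
qed

section \<open>Eigenvalues as zeros of the Dirichlet solution\<close>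

lemma sol_unique:
  fixes y p q :: "real \<Rightarrow> complex"
  assumes q: "continuous_on {0..a} q"
    and y: "\<And>x. x \<in> {0..a} \<Longrightarrow> (y has_vector_derivative p x) (at x within {0..a})"
    and p: "\<And>x. x \<in> {0..a} \<Longrightarrow> (p has_vector_derivative q x * y x) (at x within {0..a})"
    and y0: "y 0 = 0" and x: "x \<in> {0..a}"
  shows "y x = p 0 * sol q x"
proof -
  obtain M where M: "\<And>x. x \<in> {0..a} \<Longrightarrow> norm (q x) \<le> M"
    using continuous_on_bounded_Icc[OF q] by blast
  have "y x - p 0 * sol q x = 0"
  proof (rule second_order_ode_zero[where a=a and q=q and M=M and p="\<lambda>x. p x - p 0 * sol_slope q x" and y="\<lambda>x. y x - p 0 * sol q x"])
    fix t assume t: "t \<in> {0..a}"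
    show "((\<lambda>x. y x - p 0 * sol q x) has_vector_derivative p t - p 0 * sol_slope q t) (at t within {0..a})"
      by (intro has_vector_derivative_diff y t has_vector_derivative_mult_right has_vector_derivative_sol q)
    have "((\<lambda>x. p x - p 0 * sol_slope q x) has_vector_derivative q t * y t - p 0 * (q t * sol q t)) (at t within {0..a})"
      by (intro has_vector_derivative_diff p t has_vector_derivative_mult_right has_vector_derivative_sol_slope q)
    then show "((\<lambda>x. p x - p 0 * sol_slope q x) has_vector_derivative q t * (y t - p 0 * sol q t)) (at t within {0..a})"
      by (simp add: algebra_simps)
  qed (use M x y0 in auto)
  then show ?thesis by simp
qed

lemma has_vector_derivative_unique_Icc:
  fixes a b x :: real
  assumes "a < b" "x \<in> {a..b}"
    and "(f has_vector_derivative d) (at x within {a..b})"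
    and "(f has_vector_derivative e) (at x within {a..b})"
  shows "d = e"
  using vector_derivative_unique_within_closed_interval[of a b x f d e] assms by simp

lemma sol_not_identically_zero:
  assumes q: "continuous_on {0..a} q" "0 < a"
  shows "\<exists>x\<in>{0..a}. sol q x \<noteq> 0"
proof (rule ccontr)
  assume "\<not> (\<exists>x\<in>{0..a}. sol q x \<noteq> 0)"
  then have z: "sol q x = 0" if "x \<in> {0..a}" for x using that by blast
  have 0: "(0::real) \<in> {0..a}" using q by auto
  have "((\<lambda>_. 0) has_vector_derivative sol_slope q 0) (at 0 within {0..a})"
    by (rule has_vector_derivative_transform[OF 0 _ has_vector_derivative_sol[OF q(1) 0]]) (simp add: z)
  from has_vector_derivative_unique_Icc[OF q(2) 0 this has_vector_derivative_const]
  show False by simp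
qed

lemma integral_lebesgue_on_Icc:
  fixes f :: "real \<Rightarrow> complex"
  assumes "continuous_on {a..b} f"
  shows "(\<integral>t. f t \<partial>lebesgue_on {a..b}) = integral {a..b} f"
  by (intro lebesgue_integral_eq_integral continuous_imp_integrable_real assms) auto

text \<open>Regularity: w agrees almost everywhere with the continuous function q y, so its integral
  p is classically differentiable and y is a classical solution. Hence y is p 0 times
  \<open>sol\<close>, where p 0 is nonzero because y is not the zero function.\<close>

lemma dirichlet_eigenvalue_imp_sol_eq_0:
  assumes v: "continuous_on {0..pi} v" and ev: "dirichlet_eigenvalue v z \<mu>"
  shows "sol (pencil v z \<mu>) pi = 0"
proof -
  obtain y x0 w p where x0: "x0 \<in> {0..pi}" "y x0 \<noteq> 0" and y0: "y 0 = 0" "y pi = 0"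
    and w: "L2_0_pi w" "AE x in lebesgue_on {0..pi}. - w x + z * complex_of_real (v x) * y x = \<mu> * y x"
    and y: "\<And>x. x \<in> {0..pi} \<Longrightarrow> (y has_vector_derivative p x) (at x within {0..pi})"
    and p: "\<And>x. x \<in> {0..pi} \<Longrightarrow> p x = p 0 + (\<integral>t. w t \<partial>lebesgue_on {0..x})"
    using ev unfolding dirichlet_eigenvalue_def dirichlet_operator_def has_L2_second_deriv_def by blast
  let ?q = "pencil v z \<mu>"
  have q: "continuous_on {0..pi} ?q" by (rule continuous_on_pencil[OF v])
  have cy: "continuous_on {0..pi} y"
    using y by (meson continuous_on_eq_continuous_within has_vector_derivative_continuous)
  have cqy: "continuous_on {0..pi} (\<lambda>t. ?q t * y t)" by (intro continuous_intros q cy)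
  have p_eq: "p x = p 0 + integral {0..x} (\<lambda>t. ?q t * y t)" if x: "x \<in> {0..pi}" for x
  proof -
    have sub: "{0..x} \<subseteq> {0..pi}" using x by auto
    have c: "continuous_on {0..x} (\<lambda>t. ?q t * y t)" by (rule continuous_on_subset[OF cqy sub])
    have "(\<integral>t. w t \<partial>lebesgue_on {0..x}) = (\<integral>t. ?q t * y t \<partial>lebesgue_on {0..x})"
    proof (rule integral_cong_AE)
      show "w \<in> borel_measurable (lebesgue_on {0..x})"
        using w(1) unfolding L2_0_pi_def by (blast intro: measurable_restrict_mono[OF _ sub])
      show "(\<lambda>t. ?q t * y t) \<in> borel_measurable (lebesgue_on {0..x})"
        by (intro borel_measurable_integrable continuous_imp_integrable_real c)
      have "AE t in lebesgue. t \<in> {0..pi} \<longrightarrow> - w t + z * complex_of_real (v t) * y t = \<mu> * y t"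
        using w(2) by (subst (asm) AE_restrict_space_iff) auto
      then have "AE t in lebesgue. t \<in> {0..x} \<longrightarrow> w t = ?q t * y t"
        by (rule AE_mp) (use sub in \<open>auto intro!: AE_I2 simp: pencil_def algebra_simps\<close>)
      then show "AE t in lebesgue_on {0..x}. w t = ?q t * y t"
        by (subst AE_restrict_space_iff) auto
    qed
    then show ?thesis using p[OF x] integral_lebesgue_on_Icc[OF c] by simp
  qed
  have p': "(p has_vector_derivative ?q x * y x) (at x within {0..pi})" if x: "x \<in> {0..pi}" for x
  proof -
    have "((\<lambda>x. p 0 + integral {0..x} (\<lambda>t. ?q t * y t)) has_vector_derivative (0 + ?q x * y x)) (at x within {0..pi})"
      by (intro has_vector_derivative_add has_vector_derivative_const integral_has_vector_derivative cqy x)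
    from has_vector_derivative_transform[OF x p_eq this] show ?thesis by simp
  qed
  have "y x = p 0 * sol ?q x" if "x \<in> {0..pi}" for x
    by (rule sol_unique[OF q y p' y0(1) that])
  from this[OF x0(1)] this[of pi] have "p 0 \<noteq> 0" "p 0 * sol ?q pi = 0"
    using x0(2) y0(2) by auto
  then show ?thesis by simp
qed

lemma dirichlet_eigenvalue_if_sol_eq_0:
  assumes v: "continuous_on {0..pi} v" and 0: "sol (pencil v z \<mu>) pi = 0"
  shows "dirichlet_eigenvalue v z \<mu>"
  unfolding dirichlet_eigenvalue_def dirichlet_operator_def has_L2_second_deriv_def
proof (intro exI conjI ballI)
  let ?q = "pencil v z \<mu>"
  have q: "continuous_on {0..pi} ?q" by (rule continuous_on_pencil[OF v])
  have c: "continuous_on {0..pi} (\<lambda>t. ?q t * sol ?q t)"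
    by (intro continuous_intros q continuous_on_sol)
  show "\<exists>x\<in>{0..pi}. sol ?q x \<noteq> 0"
    by (rule sol_not_identically_zero[OF q pi_gt_zero])
  show "sol ?q 0 = 0" "sol ?q pi = 0" using 0 by auto
  have "continuous_on {0..pi} (\<lambda>x. (cmod (?q x * sol ?q x))\<^sup>2)"
    by (intro continuous_intros c)
  then show "L2_0_pi (\<lambda>t. ?q t * sol ?q t)"
    unfolding L2_0_pi_def
    by (intro conjI borel_measurable_integrable continuous_imp_integrable_real c)
  show "(sol ?q has_vector_derivative sol_slope ?q x) (at x within {0..pi})" if "x \<in> {0..pi}" for x
    by (rule has_vector_derivative_sol[OF q that])
  show "sol_slope ?q x = sol_slope ?q 0 + (\<integral>t. ?q t * sol ?q t \<partial>lebesgue_on {0..x})" if x: "x \<in> {0..pi}" for x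
    using sol_slope_eq[OF q x] integral_lebesgue_on_Icc[OF continuous_on_subset[OF c], of 0 x] x by auto
  show "AE x in lebesgue_on {0..pi}. - (?q x * sol ?q x) + z * complex_of_real (v x) * sol ?q x = \<mu> * sol ?q x"
    by (intro AE_I2) (simp add: pencil_def algebra_simps)
qed

lemma dirichlet_eigenvalue_iff:
  assumes "continuous_on {0..pi} v"
  shows "dirichlet_eigenvalue v z \<mu> \<longleftrightarrow> sol (pencil v z \<mu>) pi = 0"
  using dirichlet_eigenvalue_imp_sol_eq_0[OF assms] dirichlet_eigenvalue_if_sol_eq_0[OF assms] by blast

section \<open>Imaginary parts of the eigenvalues\<close>

text \<open>The Wronskian-type quantity \<open>Im (y' cnj y)\<close> has derivative \<open>Im q \<bar>y\<bar>\<^sup>2\<close> and vanishes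
  at both ends, so \<open>Im q\<close> cannot have a strict sign.\<close>

lemma Im_potential_sign:
  assumes q: "continuous_on {0..a} q" "0 < a" and 0: "sol q a = 0"
    and neg: "\<And>x. x \<in> {0..a} \<Longrightarrow> s * Im (q x) < 0"
  shows False
proof -
  define h where "h x = s * Im (sol_slope q x * cnj (sol q x))" for x
  define h' where "h' x = s * Im (q x) * (cmod (sol q x))\<^sup>2" for x
  have h: "(h has_real_derivative h' t) (at t within {0..a})" if t: "t \<in> {0..a}" for t
  proof -
    have "((\<lambda>x. sol_slope q x * cnj (sol q x)) has_vector_derivative
        sol_slope q t * cnj (sol_slope q t) + q t * sol q t * cnj (sol q t)) (at t within {0..a})"
      by (intro has_vector_derivative_mult has_vector_derivative_cnj has_vector_derivative_sol
          has_vector_derivative_sol_slope q t)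
    then have "((\<lambda>x. s * Im (sol_slope q x * cnj (sol q x))) has_vector_derivative
        s * Im (sol_slope q t * cnj (sol_slope q t) + q t * sol q t * cnj (sol q t))) (at t within {0..a})"
      by (intro has_vector_derivative_mult_right bounded_linear.has_vector_derivative[OF bounded_linear_Im])
    also have "Im (sol_slope q t * cnj (sol_slope q t) + q t * sol q t * cnj (sol q t)) = Im (q t) * (cmod (sol q t))\<^sup>2"
      unfolding cmod_power2 by (simp add: algebra_simps power2_eq_square)
    finally show ?thesis
      unfolding h_def h'_def has_real_derivative_iff_has_vector_derivative by (simp add: mult_ac)
  qed
  have neg': "h' t \<le> 0" if "t \<in> {0..a}" for t
    unfolding h'_def by (rule mult_nonpos_nonneg[OF less_imp_le[OF neg[OF that]]]) auto
  \<comment> \<open>A monotone function with equal end values is constant, so its derivative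
    \<open>h'\<close> vanishes everywhere, in particular at a point where \<open>sol\<close> does
    not.\<close>
  have "h 0 = 0" "h a = 0" by (auto simp: h_def 0)
  then have h0: "h t = 0" if "t \<in> {0..a}" for t
    using nonincreasing_Icc[OF h neg', of 0 t] nonincreasing_Icc[OF h neg', of t a] that by auto
  obtain x where x: "x \<in> {0..a}" "sol q x \<noteq> 0"
    using sol_not_identically_zero[OF q] by blast
  have "(h has_vector_derivative 0) (at x within {0..a})"
    by (rule has_vector_derivative_transform[OF x(1) _ has_vector_derivative_const[of 0]]) (use h0 in auto)
  moreover have "(h has_vector_derivative h' x) (at x within {0..a})"
    using h[OF x(1)] by (simp add: has_real_derivative_iff_has_vector_derivative)
  ultimately have "h' x = 0"
    using has_vector_derivative_unique_Icc[OF q(2) x(1)] by metis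
  with neg[OF x(1)] x(2) show False by (auto simp: h'_def)
qed

text \<open>Here Im q = v Im z - Im \<mu>. If |Im \<mu>| exceeded V |z|, the term Im \<mu> would
  dominate and q would have an imaginary part of strict sign. Only z v contributes besides \<mu>, so
  the bound is linear in |z| with no additive constant.\<close>

lemma Im_eigenvalue_le:
  assumes v: "continuous_on {0..pi} v" "\<And>x. x \<in> {0..pi} \<Longrightarrow> \<bar>v x\<bar> \<le> V"
    and 0: "sol (pencil v z \<mu>) pi = 0"
  shows "\<bar>Im \<mu>\<bar> \<le> V * norm z"
proof (rule ccontr)
  assume A: "\<not> \<bar>Im \<mu>\<bar> \<le> V * norm z"
  have "sgn (Im \<mu>) * Im (pencil v z \<mu> x) < 0" if x: "x \<in> {0..pi}" for x
  proof -
    have "\<bar>Im z * v x\<bar> \<le> norm z * V"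
      unfolding abs_mult using v(2)[OF x] abs_Im_le_cmod[of z] by (intro mult_mono) auto
    then have "\<bar>Im z * v x\<bar> < \<bar>Im \<mu>\<bar>" using A by (simp add: mult_ac)
    then show ?thesis
      by (auto simp: pencil_def sgn_if abs_if split: if_splits)
  qed
  then show False
    using Im_potential_sign[OF continuous_on_pencil[OF v(1)] pi_gt_zero 0] by blast
qed

section \<open>The unperturbed problem z = 0\<close>

lemma sol_free:
  assumes \<mu>: "\<mu> = w\<^sup>2" "w \<noteq> 0" and x: "x \<in> {0..a}"
  shows "sol (pencil v 0 \<mu>) x = sin (w * of_real x) / w"
proof -
  have q: "pencil v 0 \<mu> = (\<lambda>_. - w\<^sup>2)" by (simp add: pencil_def fun_eq_iff \<mu>)
  have "sin (w * of_real x) / w = cos (w * of_real 0) * sol (\<lambda>_. - w\<^sup>2) x"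
  proof (rule sol_unique[OF _ _ _ _ x, where y="\<lambda>x. sin (w * of_real x) / w" and p="\<lambda>x. cos (w * of_real x)"])
    fix t :: real
    have "((\<lambda>z. sin (w * z) / w) has_field_derivative cos (w * of_real t)) (at (of_real t))"
      using \<mu>(2) by (auto intro!: derivative_eq_intros)
    from has_vector_derivative_real_field[OF this]
    show "((\<lambda>x. sin (w * of_real x) / w) has_vector_derivative cos (w * of_real t)) (at t within {0..a})" .
    have "((\<lambda>z. cos (w * z)) has_field_derivative - w\<^sup>2 * (sin (w * of_real t) / w)) (at (of_real t))"
      using \<mu>(2) by (auto intro!: derivative_eq_intros simp: power2_eq_square)
    from has_vector_derivative_real_field[OF this]
    show "((\<lambda>x. cos (w * of_real x)) has_vector_derivative - w\<^sup>2 * (sin (w * of_real t) / w)) (at t within {0..a})" .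
  qed auto
  then show ?thesis by (simp add: q)
qed

lemma sol_free_nat:
  assumes "n \<ge> 1" "x \<ge> 0"
  shows "sol (pencil v 0 ((of_nat n)\<^sup>2)) x = of_real (sin (real n * x) / real n)"
proof -
  have "(of_nat n * of_real x :: complex) = of_real (real n * x)" by simp
  then have "sin (of_nat n * of_real x :: complex) = of_real (sin (real n * x))"
    by (simp only: sin_of_real)
  then show ?thesis
    using sol_free[of _ "of_nat n" x x v, OF refl] assms by simp
qed

text \<open>The point n^2 lies off the cut of \<open>csqrt\<close>, and near it the solution at pi
  is sin(pi sqrt \<mu>) / sqrt \<mu>. Its derivative at n^2 is (-1)^n pi / (2 n^2).\<close>

lemma sol_free_simple_zero:
  assumes "n \<ge> 1"
  obtains c where "c \<noteq> 0"
    "((\<lambda>\<mu>. sol (pencil v 0 \<mu>) pi) has_field_derivative c) (at ((of_nat n)\<^sup>2))"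
proof -
  let ?m = "(of_nat n)\<^sup>2 :: complex"
  have cs: "csqrt ?m = of_nat n" by (rule csqrt_unique) auto
  have ne: "?m \<notin> \<real>\<^sub>\<le>\<^sub>0"
  proof -
    have "?m = of_real ((real n)\<^sup>2)" by simp
    then show ?thesis
      unfolding complex_nonpos_Reals_iff using assms by (simp only: Re_complex_of_real) auto
  qed
  have "((\<lambda>\<mu>. sin (csqrt \<mu> * of_real pi) / csqrt \<mu>) has_field_derivative
      cos (of_nat n * of_real pi) * of_real pi / (2 * of_nat n * of_nat n)) (at ?m)"
  proof -
    have n: "of_nat n \<noteq> (0::complex)" using assms by simp
    have "sin (of_nat n * of_real pi :: complex) = 0"
      by (metis of_real_mult of_real_of_nat_eq of_real_0 sin_npi sin_of_real)
    moreover have "((\<lambda>\<mu>. sin (csqrt \<mu> * of_real pi) / csqrt \<mu>) has_field_derivative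
      ((cos (csqrt ?m * of_real pi) * (inverse (2 * csqrt ?m) * of_real pi)) * csqrt ?m
         - sin (csqrt ?m * of_real pi) * inverse (2 * csqrt ?m)) / (csqrt ?m * csqrt ?m)) (at ?m)"
      by (intro DERIV_divide DERIV_fun_sin DERIV_cmult_right has_field_derivative_csqrt ne)
        (use n cs in simp)
    ultimately show ?thesis using n unfolding cs by (simp add: field_simps)
  qed
  moreover have "eventually (\<lambda>\<mu>. sin (csqrt \<mu> * of_real pi) / csqrt \<mu> = sol (pencil v 0 \<mu>) pi) (nhds ?m)"
  proof -
    have "eventually (\<lambda>\<mu>. \<mu> \<noteq> 0) (nhds ?m)"
      using assms by (intro t1_space_nhds) auto
    then show ?thesis
      by (rule eventually_mono) (use sol_free[of _ "csqrt _" pi pi v] in auto)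
  qed
  ultimately have "((\<lambda>\<mu>. sol (pencil v 0 \<mu>) pi) has_field_derivative
      cos (of_nat n * of_real pi) * of_real pi / (2 * of_nat n * of_nat n)) (at ?m)"
    by (subst (asm) DERIV_cong_ev[OF refl _ refl]) auto
  moreover have "cos (of_nat n * of_real pi :: complex) \<noteq> 0"
  proof -
    have "(of_nat n * of_real pi :: complex) = of_real (real n * pi)" by simp
    then have "cos (of_nat n * of_real pi :: complex) = of_real (cos (real n * pi))"
      by (simp only: cos_of_real)
    then show ?thesis by (simp only: cos_npi) simp
  qed
  ultimately show ?thesis using assms by (intro that[rotated]) auto
qed

section \<open>A holomorphic implicit function theorem\<close>

text \<open>Cauchy's inequality turns uniform closeness into closeness of derivatives, so the
  implicit function theorem can work from joint continuity of F, with no separate control of the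
  \<mu>-derivative as z varies.\<close>

lemma deriv_close_if_close:
  assumes f: "f holomorphic_on cball w r" and g: "g holomorphic_on cball w r" and r: "0 < r"
    and le: "\<And>x. x \<in> cball w r \<Longrightarrow> norm (f x - g x) \<le> B"
  shows "norm (deriv f w - deriv g w) \<le> B / r"
proof -
  have h: "(\<lambda>x. f x - g x) holomorphic_on cball w r" by (intro holomorphic_intros f g)
  have "norm ((deriv ^^ 1) (\<lambda>x. f x - g x) w) \<le> fact 1 * B / r ^ 1"
    by (rule Cauchy_inequality) (use h r in \<open>auto intro!: le holomorphic_on_imp_continuous_on
        intro: holomorphic_on_subset simp: dist_norm\<close>)
  moreover have "deriv (\<lambda>x. f x - g x) w = deriv f w - deriv g w"
    using f g r by (intro deriv_diff holomorphic_on_imp_differentiable_at[of _ "ball w r"])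
      (auto intro: holomorphic_on_subset)
  ultimately show ?thesis by simp
qed

lemma norm_triangle_diff:
  fixes a b c :: "'a::real_normed_vector"
  shows "norm (a - c) \<le> norm (a - b) + norm (b - c)"
  using norm_triangle_ineq[of "a - b" "b - c"] by simp

text \<open>Newton iteration with the derivative frozen at c: E z is the fixed point of \<mu> - F z
  \<mu> / c. The hypothesis on curves makes every iterate holomorphic in z, and uniform convergence
  passes this on to E. Uniqueness in a whole disc about m is part of the conclusion, since other
  continuous branches have to be identified with E.\<close>

lemma holomorphic_implicit_function:
  fixes F :: "complex \<Rightarrow> complex \<Rightarrow> complex"
  assumes cont: "continuous_on UNIV (\<lambda>(z, \<mu>). F z \<mu>)"
    and hol: "\<And>z. F z holomorphic_on UNIV"
    and comp: "\<And>f A. open A \<Longrightarrow> f holomorphic_on A \<Longrightarrow> (\<lambda>z. F z (f z)) holomorphic_on A"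
    and zero: "F 0 m = 0" and der: "(F 0 has_field_derivative c) (at m)" "c \<noteq> 0"
  obtains E \<epsilon> \<delta> where "0 < \<epsilon>" "0 < \<delta>" "E holomorphic_on ball 0 \<delta>" "E 0 = m"
    "\<And>z. z \<in> ball 0 \<delta> \<Longrightarrow> F z (E z) = 0"
    "\<And>z \<mu>. z \<in> ball 0 \<delta> \<Longrightarrow> \<mu> \<in> cball m \<epsilon> \<Longrightarrow> F z \<mu> = 0 \<Longrightarrow> \<mu> = E z"
proof -
  have holF: "F z holomorphic_on S" for z S by (rule holomorphic_on_subset[OF hol]) simp
  have dF: "(F z has_field_derivative deriv (F z) \<mu>) (at \<mu>)" for z \<mu>
    using holomorphic_derivI[OF hol open_UNIV] by simp
  have dm: "deriv (F 0) m = c" using DERIV_imp_deriv[OF der(1)] .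
  have "isCont (deriv (F 0)) m"
    using holomorphic_on_imp_continuous_on[OF holomorphic_deriv[OF hol[of 0] open_UNIV]]
    by (simp add: continuous_on_eq_continuous_at)
  then obtain e where e: "e > 0" "\<And>\<mu>. dist \<mu> m < e \<Longrightarrow> dist (deriv (F 0) \<mu>) c < norm c / 4"
    unfolding continuous_at dm[symmetric] tendsto_iff eventually_at
    using der(2) dm continuous_at_eps_delta
    by (metis \<open>isCont (deriv (F 0)) m\<close> continuous_at_eps_delta dm zero_less_norm_iff zero_less_divide_iff zero_less_numeral)
  define \<epsilon> where "\<epsilon> = e / 2"
  have \<epsilon>: "\<epsilon> > 0" "\<epsilon> < e" using e by (auto simp: \<epsilon>_def)
  \<comment> \<open>Radius 2 \<epsilon> leaves room for Cauchy estimates on discs of radius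
    \<epsilon> centred in \<open>cball m \<epsilon>\<close>. The tolerance |c| \<epsilon> / 8
    becomes |c| / 8 for derivatives, and 1/8 + 1/4 <= 1/2 gives the contraction factor 1/2.\<close>
  let ?K = "cball (0::complex) 1 \<times> cball m (2 * \<epsilon>)"
  have "uniformly_continuous_on ?K (\<lambda>(z, \<mu>). F z \<mu>)"
    by (intro compact_uniformly_continuous continuous_on_subset[OF cont] compact_Times) auto
  moreover have "norm c * \<epsilon> / 8 > 0" using der \<epsilon> by simp
  ultimately obtain d where d: "d > 0" "\<And>p p'. p \<in> ?K \<Longrightarrow> p' \<in> ?K \<Longrightarrow> dist p' p < d \<Longrightarrow>
      dist ((\<lambda>(z, \<mu>). F z \<mu>) p') ((\<lambda>(z, \<mu>). F z \<mu>) p) < norm c * \<epsilon> / 8"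
    unfolding uniformly_continuous_on_def by blast
  define \<delta> where "\<delta> = min d 1"
  have \<delta>: "\<delta> > 0" using d by (simp add: \<delta>_def)
  have close: "norm (F z \<mu> - F 0 \<mu>) \<le> norm c * \<epsilon> / 8"
    if "z \<in> ball 0 \<delta>" "\<mu> \<in> cball m (2 * \<epsilon>)" for z \<mu>
    using d(2)[of "(0, \<mu>)" "(z, \<mu>)"] that by (auto simp: \<delta>_def dist_Pair_Pair dist_norm)
  define g where "g z \<mu> = \<mu> - F z \<mu> / c" for z \<mu>
  have dg: "(g z has_field_derivative 1 - deriv (F z) \<mu> / c) (at \<mu> within S)" for z \<mu> S
    unfolding g_def[abs_def] by (intro DERIV_diff DERIV_ident DERIV_cdivide has_field_derivative_at_within[OF dF])
  have dg_le: "norm (1 - deriv (F z) \<mu> / c) \<le> 1 / 2" if z: "z \<in> ball 0 \<delta>" and \<mu>: "\<mu> \<in> cball m \<epsilon>" for z \<mu>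
  proof -
    have sub: "x \<in> cball m (2 * \<epsilon>)" if "x \<in> cball \<mu> \<epsilon>" for x
      using that \<mu> dist_triangle[of m x \<mu>] by (auto simp: dist_commute)
    have 1: "norm (deriv (F z) \<mu> - deriv (F 0) \<mu>) \<le> (norm c * \<epsilon> / 8) / \<epsilon>"
      by (rule deriv_close_if_close[OF holF holF \<epsilon>(1)]) (rule close[OF z sub])
    have 2: "norm (deriv (F 0) \<mu> - c) \<le> norm c / 4"
      using e(2)[of \<mu>] \<mu> \<epsilon> by (auto simp: dist_norm norm_minus_commute)
    have "norm (deriv (F z) \<mu> - c) \<le> norm (deriv (F z) \<mu> - deriv (F 0) \<mu>) + norm (deriv (F 0) \<mu> - c)"
      by (rule norm_triangle_diff)
    also have "\<dots> \<le> norm c / 8 + norm c / 4" using 1 2 \<epsilon> by (intro add_mono) simp_all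
    also have "\<dots> \<le> norm c / 2" by simp
    finally have "norm (deriv (F z) \<mu> - c) \<le> norm c / 2" .
    moreover have "1 - deriv (F z) \<mu> / c = - (deriv (F z) \<mu> - c) / c" using der(2) by (simp add: field_simps)
    ultimately show ?thesis using der(2) by (simp add: norm_divide norm_minus_commute field_simps)
  qed
  have lip: "norm (g z \<mu> - g z \<nu>) \<le> 1 / 2 * norm (\<mu> - \<nu>)"
    if "z \<in> ball 0 \<delta>" "\<mu> \<in> cball m \<epsilon>" "\<nu> \<in> cball m \<epsilon>" for z \<mu> \<nu>
    by (rule field_differentiable_bound[OF convex_cball dg dg_le]) (use that in auto)
  have gm: "norm (g z m - m) \<le> \<epsilon> / 2" if "z \<in> ball 0 \<delta>" for z
  proof -
    have "norm (F z m) \<le> norm c * (\<epsilon> / 2)"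
      using close[OF that, of m] \<epsilon> zero mult_nonneg_nonneg[OF norm_ge_zero[of c] less_imp_le[OF \<epsilon>(1)]]
      by (simp del: zero_le_mult_iff mult_nonneg_nonneg)
    then show ?thesis using der(2) by (simp add: g_def norm_divide field_simps)
  qed
  have into: "g z \<mu> \<in> cball m \<epsilon>" if "z \<in> ball 0 \<delta>" "\<mu> \<in> cball m \<epsilon>" for z \<mu>
  proof -
    have "norm (g z \<mu> - m) \<le> norm (g z \<mu> - g z m) + norm (g z m - m)"
      by (rule norm_triangle_diff)
    also have "\<dots> \<le> 1 / 2 * norm (\<mu> - m) + \<epsilon> / 2"
      using that \<epsilon> by (intro add_mono lip gm) auto
    also have "\<dots> \<le> \<epsilon>" using that by (simp add: dist_norm norm_minus_commute)
    finally show ?thesis by (simp add: dist_norm norm_minus_commute)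
  qed
  define I where "I k z = ((g z) ^^ k) m" for k z
  have I_Suc: "I (Suc k) z = g z (I k z)" for k z by (simp add: I_def)
  have I_in: "I k z \<in> cball m \<epsilon>" if "z \<in> ball 0 \<delta>" for k z
    by (induction k) (use \<epsilon> that into in \<open>auto simp: I_def simp del: mem_cball\<close>)
  have I_step: "norm (I (Suc k) z - I k z) \<le> \<epsilon> * (1 / 2) ^ k" if z: "z \<in> ball 0 \<delta>" for k z
  proof (induction k)
    case 0
    show ?case using gm[OF z] \<epsilon> by (simp add: I_def)
  next
    case (Suc k)
    have "norm (I (Suc (Suc k)) z - I (Suc k) z) \<le> 1 / 2 * norm (I (Suc k) z - I k z)"
      unfolding I_Suc[of "Suc k"] I_Suc[of k]
      using lip[OF z into[OF z I_in[OF z, of k]] I_in[OF z, of k]] .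
    with Suc show ?case by simp
  qed
  \<comment> \<open>Writing the limit as a telescoping series lets the M-test supply uniform
    convergence of the iterates.\<close>
  define E where "E z = m + (\<Sum>k. I (Suc k) z - I k z)" for z
  have "uniform_limit (ball 0 \<delta>) (\<lambda>N z. \<Sum>k<N. I (Suc k) z - I k z) (\<lambda>z. \<Sum>k. I (Suc k) z - I k z) sequentially"
    by (rule Weierstrass_m_test[OF I_step]) (auto intro!: summable_mult summable_geometric)
  then have "uniform_limit (ball 0 \<delta>) (\<lambda>N z. m + (\<Sum>k<N. I (Suc k) z - I k z)) E sequentially"
    unfolding E_def[abs_def] by (intro uniform_limit_add uniform_limit_const)
  moreover have "m + (\<Sum>k<N. I (Suc k) z - I k z) = I N z" for N z
    by (subst sum_lessThan_telescope) (simp add: I_def)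
  ultimately have ul: "uniform_limit (ball 0 \<delta>) I E sequentially" by simp
  have holI: "I k holomorphic_on ball 0 \<delta>" for k
  proof (induction k)
    case 0
    then show ?case by (simp add: I_def[abs_def])
  next
    case (Suc k)
    have "I (Suc k) = (\<lambda>z. I k z - F z (I k z) / c)" by (simp add: fun_eq_iff I_Suc g_def)
    then show ?case using der(2) by (auto intro!: holomorphic_intros comp Suc)
  qed
  have holE: "E holomorphic_on ball 0 \<delta>"
  proof (rule holomorphic_uniform_sequence[OF open_ball holI])
    fix x :: complex assume "x \<in> ball 0 \<delta>"
    then obtain d where "d > 0" "cball x d \<subseteq> ball 0 \<delta>" using open_contains_cball open_ball by blast
    with ul show "\<exists>d>0. cball x d \<subseteq> ball 0 \<delta> \<and> uniform_limit (cball x d) I E sequentially"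
      by (meson uniform_limit_on_subset)
  qed
  have lim: "(\<lambda>k. I k z) \<longlonglongrightarrow> E z" if "z \<in> ball 0 \<delta>" for z
    using tendsto_uniform_limitI[OF ul that] .
  have E_in: "E z \<in> cball m \<epsilon>" if z: "z \<in> ball 0 \<delta>" for z
    by (rule closed_sequentially[OF closed_cball _ lim[OF z]]) (rule I_in[OF z])
  have fp: "g z (E z) = E z" if z: "z \<in> ball 0 \<delta>" for z
  proof -
    have "(\<lambda>k. g z (I k z)) \<longlonglongrightarrow> g z (E z)"
      by (rule isCont_tendsto_compose[OF DERIV_isCont[OF dg] lim[OF z]])
    moreover have "(\<lambda>k. g z (I k z)) \<longlonglongrightarrow> E z"
      using LIMSEQ_Suc[OF lim[OF z]] by (simp add: I_Suc)
    ultimately show ?thesis by (rule LIMSEQ_unique)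
  qed
  have F0: "F z (E z) = 0" if z: "z \<in> ball 0 \<delta>" for z
    using fp[OF z] der(2) by (simp add: g_def)
  have uniq: "\<mu> = E z" if z: "z \<in> ball 0 \<delta>" and \<mu>: "\<mu> \<in> cball m \<epsilon>" "F z \<mu> = 0" for z \<mu>
    using lip[OF z \<mu>(1) E_in[OF z]] F0[OF z] \<mu>(2) by (simp add: g_def)
  show ?thesis
    by (rule that[OF \<epsilon>(1) \<delta> holE _ F0 uniq]) (use uniq[of 0 m] \<delta> \<epsilon> zero in auto)
qed

section \<open>A coefficient bound from the imaginary part\<close>

text \<open>On the circle, \<open>cnj f\<close> has only nonpositive frequencies, so the second Fourier coefficient of
  \<open>f\<close> is that of \<open>f - cnj f\<close>.\<close>

lemma second_deriv_bound_by_Im: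
  assumes f: "f holomorphic_on cball 0 r" and r: "0 < r"
    and B: "\<And>z. norm z = r \<Longrightarrow> \<bar>Im (f z)\<bar> \<le> B"
  shows "norm ((deriv ^^ 2) f 0) / 2 * r\<^sup>2 \<le> 2 * B"
proof -
  define e where "e t = exp (2 * of_real pi * \<i> * of_real t)" for t :: real
  define \<gamma> where "\<gamma> t = of_real r * e t" for t
  let ?d = "(deriv ^^ 2) f 0"
  have \<gamma>: "circlepath 0 r = \<gamma>" by (simp add: fun_eq_iff circlepath \<gamma>_def e_def mult_ac)
  have norm_e: "norm (e t) = 1" for t
    by (simp add: e_def norm_exp_eq_Re)
  then have e_cnj: "e t * cnj (e t) = 1" for t
    using complex_norm_square[of "e t"] by simp
  have d\<gamma>: "vector_derivative (circlepath 0 r) (at t within {0..1}) = 2 * of_real pi * \<i> * \<gamma> t"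
    if "t \<in> {0..1}" for t
    using that by (subst vector_derivative_circlepath01) (auto simp: \<gamma>_def e_def mult_ac)
  have "((\<lambda>u. f u / (u - 0) ^ Suc 2) has_contour_integral (2 * pi * \<i>) / fact 2 * ?d) (circlepath 0 r)"
    by (rule Cauchy_has_contour_integral_higher_derivative_circlepath)
      (use f r in \<open>auto intro: holomorphic_on_imp_continuous_on holomorphic_on_subset\<close>)
  then have "((\<lambda>t. f (\<gamma> t) / \<gamma> t ^ Suc 2 * (2 * of_real pi * \<i> * \<gamma> t)) has_integral (2 * pi * \<i>) / fact 2 * ?d) {0..1}"
    unfolding has_contour_integral_def \<gamma>
    by (rule has_integral_eq[rotated]) (simp only: d\<gamma>[unfolded \<gamma>] diff_zero)
  \<comment> \<open>This factor turns Cauchy's formula into a Fourier coefficient: on the circle, 1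
    / u^2 is the squared conjugate of \<open>e t\<close>, divided by r^2.\<close>
  from has_integral_mult_right[OF this, of "of_real (r\<^sup>2) / (2 * of_real pi * \<i>)"]
  have "((\<lambda>t. f (\<gamma> t) * (cnj (e t))\<^sup>2) has_integral ?d / 2 * of_real (r\<^sup>2)) {0..1}"
  proof (rule has_integral_eq_rhs[OF has_integral_eq[rotated]])
    fix t
    have ne: "e t \<noteq> 0" by (simp add: e_def)
    have c: "cnj (e t) = 1 / e t" using e_cnj[of t] ne by (simp add: field_simps)
    show "of_real (r\<^sup>2) / (2 * of_real pi * \<i>) * (f (\<gamma> t) / \<gamma> t ^ Suc 2 * (2 * of_real pi * \<i> * \<gamma> t))
      = f (\<gamma> t) * (cnj (e t))\<^sup>2"
      unfolding c \<gamma>_def using r ne by (simp add: field_simps power2_eq_square power3_eq_cube)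
  qed (simp add: fact_2 field_simps)
  \<comment> \<open>Up to conjugation and the factor r^2 this is the mean of f(u) u^2 over the
    circle, that is, the value of a holomorphic function with a zero at 0.\<close>
  moreover have "((\<lambda>t. cnj (f (\<gamma> t)) * (cnj (e t))\<^sup>2) has_integral 0) {0..1}"
  proof -
    have h: "(\<lambda>u. f u * u\<^sup>2) holomorphic_on cball 0 r" by (intro holomorphic_intros f)
    have "((\<lambda>u. (f u * u\<^sup>2) / (u - 0) ^ Suc 0) has_contour_integral (2 * pi * \<i>) / fact 0 * (deriv ^^ 0) (\<lambda>u. f u * u\<^sup>2) 0) (circlepath 0 r)"
      by (rule Cauchy_has_contour_integral_higher_derivative_circlepath
          [OF holomorphic_on_imp_continuous_on[OF h] holomorphic_on_subset[OF h ball_subset_cball]])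
        (use r in simp)
    then have "((\<lambda>t. (f (\<gamma> t) * (\<gamma> t)\<^sup>2) / (\<gamma> t - 0) ^ Suc 0 * (2 * of_real pi * \<i> * \<gamma> t)) has_integral 0) {0..1}"
      unfolding has_contour_integral_def \<gamma>
      by (rule has_integral_eq_rhs[OF has_integral_eq[rotated]])
        (simp_all only: d\<gamma>[unfolded \<gamma>], simp_all)
    from has_integral_mult_right[OF this, of "1 / (2 * of_real pi * \<i> * of_real (r\<^sup>2))"]
    have "((\<lambda>t. f (\<gamma> t) * (e t)\<^sup>2) has_integral 0) {0..1}"
    proof (rule has_integral_eq_rhs[OF has_integral_eq[rotated]])
      fix t
      have ne: "e t \<noteq> 0" by (simp add: e_def)
      show "1 / (2 * of_real pi * \<i> * of_real (r\<^sup>2)) * ((f (\<gamma> t) * (\<gamma> t)\<^sup>2) / (\<gamma> t - 0) ^ Suc 0 * (2 * of_real pi * \<i> * \<gamma> t))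
        = f (\<gamma> t) * (e t)\<^sup>2"
        using r ne by (simp add: \<gamma>_def field_simps power2_eq_square)
    qed simp
    then have "((cnj \<circ> (\<lambda>t. f (\<gamma> t) * (e t)\<^sup>2)) has_integral cnj 0) {0..1}"
      by (simp only: has_integral_cnj)
    then show ?thesis by (simp add: o_def)
  qed
  ultimately have "((\<lambda>t. f (\<gamma> t) * (cnj (e t))\<^sup>2 - cnj (f (\<gamma> t)) * (cnj (e t))\<^sup>2) has_integral ?d / 2 * of_real (r\<^sup>2) - 0) {0..1}"
    by (rule has_integral_diff)
  moreover have "norm (f (\<gamma> t) * (cnj (e t))\<^sup>2 - cnj (f (\<gamma> t)) * (cnj (e t))\<^sup>2) \<le> 2 * B" for t
  proof -
    have "f (\<gamma> t) * (cnj (e t))\<^sup>2 - cnj (f (\<gamma> t)) * (cnj (e t))\<^sup>2 = (f (\<gamma> t) - cnj (f (\<gamma> t))) * (cnj (e t))\<^sup>2"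
      by (simp add: algebra_simps)
    also have "f (\<gamma> t) - cnj (f (\<gamma> t)) = of_real (2 * Im (f (\<gamma> t))) * \<i>"
      by (rule complex_diff_cnj)
    also have "norm (of_real (2 * Im (f (\<gamma> t))) * \<i> * (cnj (e t))\<^sup>2) = 2 * \<bar>Im (f (\<gamma> t))\<bar>"
      by (simp add: norm_mult norm_power norm_e)
    finally show ?thesis
      using B[of "\<gamma> t"] r by (simp add: \<gamma>_def norm_mult norm_e)
  qed
  moreover have "0 \<le> B" using B[of "of_real r"] r by (simp add: order_trans[OF abs_ge_zero])
  ultimately have "norm (?d / 2 * of_real (r\<^sup>2) - 0) \<le> 2 * B"
    using has_integral_bound_real[of "2 * B" "{}" "\<lambda>t. f (\<gamma> t) * (cnj (e t))\<^sup>2 - cnj (f (\<gamma> t)) * (cnj (e t))\<^sup>2"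
        "?d / 2 * of_real (r\<^sup>2) - 0" 0 1] by simp
  then show ?thesis by (simp add: norm_mult norm_divide norm_power)
qed

section \<open>Fourier coefficients of the potential\<close>

text \<open>The even extension of the coefficients to all integers. Its value at 0 is 0 because v
  has mean zero, whatever \<open>a 0\<close> may be.\<close>

definition even_coeff :: "(nat \<Rightarrow> real) \<Rightarrow> int \<Rightarrow> real" where
  "even_coeff a j = (if j = 0 then 0 else a (nat \<bar>j\<bar>))"

lemma has_integral_cos_even:
  "((\<lambda>x. cos (2 * of_int j * x)) has_integral (if j = 0 then pi else 0)) {0..pi}"
proof (cases "j = 0")
  case False
  have "((\<lambda>x. cos (2 * of_int j * x)) has_integral
      sin (2 * of_int j * pi) / (2 * of_int j) - sin (2 * of_int j * 0) / (2 * of_int j)) {0..pi}"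
    by (rule fundamental_theorem_of_calculus)
      (use False in \<open>auto intro!: derivative_eq_intros simp flip: has_real_derivative_iff_has_vector_derivative\<close>)
  moreover have "sin (2 * of_int j * pi) = 0"
    using sin_npi_int[of "2 * j"] by (simp add: mult_ac)
  ultimately show ?thesis using False by simp
qed (use has_integral_const_real[of "1::real" 0 pi] in simp)

context
  fixes a :: "nat \<Rightarrow> real" and \<sigma> :: real
  assumes \<sigma>: "(\<lambda>k. \<bar>a (Suc k)\<bar>) sums \<sigma>"
begin

lemma uniform_limit_cosine_potential:
  "uniform_limit S (\<lambda>N x. \<Sum>k<N. a (Suc k) * sqrt 2 * cos (2 * real (Suc k) * x)) (cosine_potential a) sequentially"
  unfolding cosine_potential_def[abs_def]
proof (rule Weierstrass_m_test)
  show "summable (\<lambda>k. \<bar>a (Suc k)\<bar> * sqrt 2)"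
    using \<sigma> by (intro summable_mult2) (rule sums_summable)
  show "norm (a (Suc k) * sqrt 2 * cos (2 * real (Suc k) * x)) \<le> \<bar>a (Suc k)\<bar> * sqrt 2" for k x
    using mult_left_mono[OF abs_cos_le_one[of "2 * real (Suc k) * x"], of "\<bar>a (Suc k)\<bar> * sqrt 2"]
    by (simp add: abs_mult del: of_nat_Suc)
qed

lemma continuous_on_cosine_potential: "continuous_on S (cosine_potential a)"
  by (rule uniform_limit_theorem[OF _ uniform_limit_cosine_potential])
    (auto intro!: always_eventually continuous_intros)

lemma abs_cosine_potential_le: "\<bar>cosine_potential a x\<bar> \<le> sqrt 2 * \<sigma>"
proof -
  have s: "(\<lambda>k. sqrt 2 * \<bar>a (Suc k)\<bar>) sums (sqrt 2 * \<sigma>)" by (rule sums_mult[OF \<sigma>])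
  have le: "norm (a (Suc k) * sqrt 2 * cos (2 * real (Suc k) * x)) \<le> sqrt 2 * \<bar>a (Suc k)\<bar>" for k
    using mult_left_mono[OF abs_cos_le_one[of "2 * real (Suc k) * x"], of "\<bar>a (Suc k)\<bar> * sqrt 2"]
    by (simp add: abs_mult mult_ac del: of_nat_Suc)
  have "norm (cosine_potential a x) \<le> (\<Sum>k. sqrt 2 * \<bar>a (Suc k)\<bar>)"
    unfolding cosine_potential_def by (rule norm_suminf_le[OF le sums_summable[OF s]])
  then show ?thesis using sums_unique[OF s] by simp
qed

text \<open>Absolute summability allows term-by-term integration against any continuous g. Taking g
  a cosine gives the Fourier coefficients, g = v gives Parseval, and g = \<open>sol\<close> times a
  sine gives the coupling between sine coefficients.\<close>

lemma cosine_potential_integral_sums: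
  fixes g :: "real \<Rightarrow> complex"
  assumes g: "continuous_on {0..pi} g"
  shows "(\<lambda>k. of_real (a (Suc k) * sqrt 2) * integral {0..pi} (\<lambda>x. of_real (cos (2 * real (Suc k) * x)) * g x))
    sums integral {0..pi} (\<lambda>x. of_real (cosine_potential a x) * g x)"
proof -
  have "uniform_limit {0..pi} (\<lambda>N x. complex_of_real (\<Sum>k<N. a (Suc k) * sqrt 2 * cos (2 * real (Suc k) * x)))
      (\<lambda>x. of_real (cosine_potential a x)) sequentially"
    by (rule bounded_linear.uniform_limit[OF bounded_linear_of_real uniform_limit_cosine_potential])
  moreover have "bounded ((\<lambda>x. complex_of_real (cosine_potential a x)) ` {0..pi})" "bounded (g ` {0..pi})"
    by (intro compact_imp_bounded compact_continuous_image g continuous_intros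
        continuous_on_cosine_potential compact_Icc)+
  ultimately have u: "uniform_limit {0..pi}
      (\<lambda>N x. complex_of_real (\<Sum>k<N. a (Suc k) * sqrt 2 * cos (2 * real (Suc k) * x)) * g x)
      (\<lambda>x. of_real (cosine_potential a x) * g x) sequentially"
    by (intro uniform_lim_mult uniform_limit_const)
  obtain I J where IJ:
    "\<And>N. ((\<lambda>x. complex_of_real (\<Sum>k<N. a (Suc k) * sqrt 2 * cos (2 * real (Suc k) * x)) * g x) has_integral I N) {0..pi}"
    "((\<lambda>x. of_real (cosine_potential a x) * g x) has_integral J) {0..pi}" "I \<longlonglongrightarrow> J"
    by (rule uniform_limit_integral[OF u]) (auto intro!: continuous_intros g)
  have "I N = (\<Sum>k<N. of_real (a (Suc k) * sqrt 2) * integral {0..pi} (\<lambda>x. of_real (cos (2 * real (Suc k) * x)) * g x))" for N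
  proof (rule has_integral_unique[OF IJ(1)])
    have "((\<lambda>x. \<Sum>k<N. of_real (a (Suc k) * sqrt 2) * (of_real (cos (2 * real (Suc k) * x)) * g x)) has_integral
        (\<Sum>k<N. of_real (a (Suc k) * sqrt 2) * integral {0..pi} (\<lambda>x. of_real (cos (2 * real (Suc k) * x)) * g x))) {0..pi}"
      by (intro has_integral_sum has_integral_mult_right integrable_integral integrable_continuous_real
          continuous_intros g finite_lessThan)
    then show "((\<lambda>x. complex_of_real (\<Sum>k<N. a (Suc k) * sqrt 2 * cos (2 * real (Suc k) * x)) * g x) has_integral
        (\<Sum>k<N. of_real (a (Suc k) * sqrt 2) * integral {0..pi} (\<lambda>x. of_real (cos (2 * real (Suc k) * x)) * g x))) {0..pi}"
      by (simp add: sum_distrib_right mult.assoc del: of_nat_Suc)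
  qed
  then have "I = (\<lambda>N. \<Sum>k<N. of_real (a (Suc k) * sqrt 2) * integral {0..pi} (\<lambda>x. of_real (cos (2 * real (Suc k) * x)) * g x))"
    by blast
  with IJ show ?thesis by (simp add: sums_def integral_unique)
qed

lemma cosine_potential_coeff:
  "integral {0..pi} (\<lambda>x. complex_of_real (cosine_potential a x) * of_real (cos (2 * of_int j * x)))
     = of_real (pi / sqrt 2 * even_coeff a j)"
proof -
  have i: "integral {0..pi} (\<lambda>x. complex_of_real (cos (2 * real (Suc k) * x)) * of_real (cos (2 * of_int j * x)))
     = of_real (if Suc k = nat \<bar>j\<bar> then pi / 2 else 0)" for k
  proof -
    have "((\<lambda>x. (cos (2 * of_int (int (Suc k) - j) * x) + cos (2 * of_int (int (Suc k) + j) * x)) / 2) has_integral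
      ((if int (Suc k) - j = 0 then pi else 0) + (if int (Suc k) + j = 0 then pi else 0)) / 2) {0..pi}"
      by (intro has_integral_divide has_integral_add has_integral_cos_even)
    also have "(\<lambda>x. (cos (2 * of_int (int (Suc k) - j) * x) + cos (2 * of_int (int (Suc k) + j) * x)) / 2)
        = (\<lambda>x. cos (2 * real (Suc k) * x) * cos (2 * of_int j * x))"
      unfolding cos_times_cos by (simp add: left_diff_distrib right_diff_distrib distrib_left distrib_right)
    also have "((if int (Suc k) - j = 0 then pi else 0) + (if int (Suc k) + j = 0 then pi else 0)) / 2
       = (if Suc k = nat \<bar>j\<bar> then pi / 2 else 0)" by auto
    finally have "((\<lambda>x. complex_of_real (cos (2 * real (Suc k) * x) * cos (2 * of_int j * x))) has_integral
        of_real (if Suc k = nat \<bar>j\<bar> then pi / 2 else 0)) {0..pi}"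
      by (rule has_integral_of_real)
    then show ?thesis by (simp add: integral_unique del: of_nat_Suc)
  qed
  have "(\<lambda>k. of_real (a (Suc k) * sqrt 2) * integral {0..pi} (\<lambda>x. of_real (cos (2 * real (Suc k) * x)) * complex_of_real (cos (2 * of_int j * x))))
    sums integral {0..pi} (\<lambda>x. of_real (cosine_potential a x) * complex_of_real (cos (2 * of_int j * x)))"
    by (intro cosine_potential_integral_sums continuous_intros)
  then have "(\<lambda>k. of_real (a (Suc k) * sqrt 2) * complex_of_real (if Suc k = nat \<bar>j\<bar> then pi / 2 else 0))
    sums integral {0..pi} (\<lambda>x. of_real (cosine_potential a x) * complex_of_real (cos (2 * of_int j * x)))"
    unfolding i .
  moreover have "(\<lambda>k. of_real (a (Suc k) * sqrt 2) * complex_of_real (if Suc k = nat \<bar>j\<bar> then pi / 2 else 0))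
    sums of_real (pi / sqrt 2 * even_coeff a j)"
  proof (cases "j = 0")
    case True
    then show ?thesis by (simp add: even_coeff_def)
  next
    case False
    then have "(\<lambda>k. of_real (a (Suc k) * sqrt 2) * complex_of_real (if Suc k = nat \<bar>j\<bar> then pi / 2 else 0))
       = (\<lambda>k. if k = nat \<bar>j\<bar> - 1 then of_real (a (nat \<bar>j\<bar>) * sqrt 2 * (pi / 2)) else 0)"
      by (auto simp: fun_eq_iff)
    moreover have "a (nat \<bar>j\<bar>) * sqrt 2 * (pi / 2) = pi / sqrt 2 * even_coeff a j"
      using False by (simp add: even_coeff_def real_div_sqrt field_simps)
    ultimately show ?thesis
      using sums_single[of "nat \<bar>j\<bar> - 1" "\<lambda>_. complex_of_real (a (nat \<bar>j\<bar>) * sqrt 2 * (pi / 2))"] by simp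
  qed
  ultimately show ?thesis by (rule sums_unique2)
qed

lemma L2_norm_cosine_potential_sums:
  "(\<lambda>k. (a (Suc k))\<^sup>2) sums (L2_norm_0_pi (cosine_potential a))\<^sup>2"
proof -
  let ?v = "cosine_potential a"
  have i: "integral {0..pi} (\<lambda>x. of_real (cos (2 * real (Suc k) * x)) * complex_of_real (?v x))
      = of_real (pi / sqrt 2 * a (Suc k))" for k
    using cosine_potential_coeff[of "int (Suc k)"] by (simp add: even_coeff_def mult_ac nat_add_distrib del: of_nat_Suc)
  have c: "complex_of_real (a (Suc k) * sqrt 2) * of_real (pi / sqrt 2 * a (Suc k)) = of_real (pi * (a (Suc k))\<^sup>2)" for k
    unfolding of_real_mult[symmetric] of_real_eq_iff by (simp add: power2_eq_square field_simps)
  have "(\<lambda>k. of_real (a (Suc k) * sqrt 2) * integral {0..pi} (\<lambda>x. of_real (cos (2 * real (Suc k) * x)) * complex_of_real (?v x)))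
    sums integral {0..pi} (\<lambda>x. of_real (?v x) * complex_of_real (?v x))"
    by (intro cosine_potential_integral_sums continuous_intros continuous_on_cosine_potential)
  also have "(\<lambda>x. of_real (?v x) * complex_of_real (?v x)) = (\<lambda>x. complex_of_real (\<bar>?v x\<bar>\<^sup>2))"
    by (simp add: power2_eq_square)
  also have "integral {0..pi} \<dots> = of_real (integral {0..pi} (\<lambda>x. \<bar>?v x\<bar>\<^sup>2))"
    by (intro integral_unique has_integral_of_real integrable_integral integrable_continuous_real
        continuous_intros continuous_on_cosine_potential)
  finally have "(\<lambda>k. complex_of_real (pi * (a (Suc k))\<^sup>2)) sums of_real (integral {0..pi} (\<lambda>x. \<bar>?v x\<bar>\<^sup>2))"
    unfolding i c .
  then have "(\<lambda>k. pi * (a (Suc k))\<^sup>2) sums integral {0..pi} (\<lambda>x. \<bar>?v x\<bar>\<^sup>2)"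
    by (simp only: sums_of_real_iff)
  from sums_divide[OF this, of pi]
  have s: "(\<lambda>k. (a (Suc k))\<^sup>2) sums (1 / pi * integral {0..pi} (\<lambda>x. \<bar>?v x\<bar>\<^sup>2))" by simp
  have "(\<integral>x. \<bar>?v x\<bar>\<^sup>2 \<partial>lebesgue_on {0..pi}) = integral {0..pi} (\<lambda>x. \<bar>?v x\<bar>\<^sup>2)"
    by (intro lebesgue_integral_eq_integral continuous_imp_integrable_real continuous_intros
        continuous_on_cosine_potential) auto
  moreover have "0 \<le> integral {0..pi} (\<lambda>x. \<bar>?v x\<bar>\<^sup>2)" by (rule integral_nonneg) (auto intro!: integrable_continuous_real continuous_intros continuous_on_cosine_potential)
  ultimately have "(L2_norm_0_pi ?v)\<^sup>2 = 1 / pi * integral {0..pi} (\<lambda>x. \<bar>?v x\<bar>\<^sup>2)"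
    unfolding L2_norm_0_pi_def by simp
  with s show ?thesis by simp
qed

end

section \<open>Sine coefficients of the eigenfunction\<close>

text \<open>The index runs over all integers, so that the shifts m + 2k and m - 2k need no case
  distinction; negative indices are handled by oddness. There is no normalisation:
  \<open>sol\<close> has slope 1 at 0, and its n-th coefficient is divided out later.\<close>

definition sine_coeff :: "(real \<Rightarrow> real) \<Rightarrow> int \<Rightarrow> complex \<Rightarrow> complex \<Rightarrow> complex" where
  "sine_coeff v m z \<mu> = integral {0..pi} (\<lambda>x. sol (pencil v z \<mu>) x * of_real (sin (of_int m * x)))"

definition potential_sine_coeff :: "(real \<Rightarrow> real) \<Rightarrow> int \<Rightarrow> complex \<Rightarrow> complex \<Rightarrow> complex" where
  "potential_sine_coeff v m z \<mu> =
     integral {0..pi} (\<lambda>x. of_real (v x) * (sol (pencil v z \<mu>) x * of_real (sin (of_int m * x))))"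

lemma sine_coeff_minus: "sine_coeff v (- m) z \<mu> = - sine_coeff v m z \<mu>"
  by (simp add: sine_coeff_def)

text \<open>Green's identity against sin(m x), whose boundary terms vanish at 0 and pi. For m = n it
  expresses E - n^2; for m different from n and - n it shows that the coefficient is of order
  z.\<close>

lemma sine_coeff_eq:
  assumes v: "continuous_on {0..pi} v" and 0: "sol (pencil v z \<mu>) pi = 0"
  shows "((of_int m)\<^sup>2 - \<mu>) * sine_coeff v m z \<mu> = - z * potential_sine_coeff v m z \<mu>"
proof -
  let ?q = "pencil v z \<mu>"
  have q: "continuous_on {0..pi} ?q" by (rule continuous_on_pencil[OF v])
  define S where "S x = complex_of_real (sin (of_int m * x))" for x
  define K where "K x = complex_of_real (cos (of_int m * x))" for x
  have dS: "(S has_vector_derivative of_int m * K x) (at x within {0..pi})" for x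
    unfolding S_def[abs_def] K_def
    by (rule has_vector_derivative_eq_rhs, rule has_vector_derivative_of_real)
      (auto intro!: derivative_eq_intros simp flip: has_real_derivative_iff_has_vector_derivative)
  have dK: "(K has_vector_derivative - (of_int m * S x)) (at x within {0..pi})" for x
    unfolding K_def[abs_def] S_def
    by (rule has_vector_derivative_eq_rhs, rule has_vector_derivative_of_real)
      (auto intro!: derivative_eq_intros simp flip: has_real_derivative_iff_has_vector_derivative)
  have "((\<lambda>x. (?q x + (of_int m)\<^sup>2) * sol ?q x * S x) has_integral
     (sol_slope ?q pi * S pi - of_int m * (sol ?q pi * K pi)) - (sol_slope ?q 0 * S 0 - of_int m * (sol ?q 0 * K 0))) {0..pi}"
  proof (rule fundamental_theorem_of_calculus)
    fix x assume x: "x \<in> {0..pi}"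
    have "((\<lambda>x. sol_slope ?q x * S x - of_int m * (sol ?q x * K x)) has_vector_derivative
       (sol_slope ?q x * (of_int m * K x) + ?q x * sol ?q x * S x)
        - of_int m * (sol ?q x * - (of_int m * S x) + sol_slope ?q x * K x)) (at x within {0..pi})"
      by (intro has_vector_derivative_diff has_vector_derivative_mult has_vector_derivative_mult_right
         dS dK has_vector_derivative_sol has_vector_derivative_sol_slope q x)
    then show "((\<lambda>x. sol_slope ?q x * S x - of_int m * (sol ?q x * K x)) has_vector_derivative
       (?q x + (of_int m)\<^sup>2) * sol ?q x * S x) (at x within {0..pi})"
      by (rule has_vector_derivative_eq_rhs) (simp add: algebra_simps power2_eq_square)
  qed simp
  moreover have "S pi = 0" "S 0 = 0"
    using sin_npi_int[of m] by (auto simp: S_def mult_ac)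
  ultimately have "((\<lambda>x. (?q x + (of_int m)\<^sup>2) * sol ?q x * S x) has_integral 0) {0..pi}"
    using 0 by simp
  moreover have "((\<lambda>x. z * (of_real (v x) * (sol ?q x * S x)) + ((of_int m)\<^sup>2 - \<mu>) * (sol ?q x * S x)) has_integral
      z * potential_sine_coeff v m z \<mu> + ((of_int m)\<^sup>2 - \<mu>) * sine_coeff v m z \<mu>) {0..pi}"
    unfolding potential_sine_coeff_def sine_coeff_def S_def
    by (intro has_integral_add has_integral_mult_right integrable_integral integrable_continuous_real
        continuous_intros v continuous_on_sol q)
  moreover have "(\<lambda>x. (?q x + (of_int m)\<^sup>2) * sol ?q x * S x) =
     (\<lambda>x. z * (of_real (v x) * (sol ?q x * S x)) + ((of_int m)\<^sup>2 - \<mu>) * (sol ?q x * S x))"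
    by (simp add: fun_eq_iff pencil_def algebra_simps)
  ultimately have "z * potential_sine_coeff v m z \<mu> + ((of_int m)\<^sup>2 - \<mu>) * sine_coeff v m z \<mu> = 0"
    by (metis has_integral_unique)
  then show ?thesis by (simp add: eq_neg_iff_add_eq_0 add.commute)
qed

lemma continuous_on_weighted_sol_integral:
  assumes v: "continuous_on {0..pi} v" and g: "continuous_on {0..pi} g"
  shows "continuous_on UNIV (\<lambda>(z, \<mu>). integral {0..pi} (\<lambda>x. sol (pencil v z \<mu>) x * g x :: complex))"
proof -
  have "continuous_on (UNIV \<times> {0..pi}) (\<lambda>p. (case (fst (fst p), snd (fst p), snd p) of (z, \<mu>, x) \<Rightarrow> sol (pencil v z \<mu>) x))"
    by (rule continuous_on_compose2[OF continuous_on_sol_pencil[OF v pi_ge_zero]])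
      (auto intro!: continuous_intros)
  then have "continuous_on (UNIV \<times> {0..pi}) (\<lambda>p. sol (pencil v (fst (fst p)) (snd (fst p))) (snd p) * g (snd p))"
    by (intro continuous_on_mult continuous_on_compose2[OF g]) (auto intro!: continuous_intros)
  then have "continuous_on (UNIV \<times> cbox 0 pi) (\<lambda>(p, x). sol (pencil v (fst p) (snd p)) x * g x)"
    by (simp add: case_prod_beta')
  from integral_continuous_on_param[OF this]
  show ?thesis by (simp add: case_prod_beta')
qed

lemma tendsto_weighted_sol_integral:
  assumes "continuous_on {0..pi} v" "continuous_on {0..pi} g" and E: "isCont E 0"
  shows "((\<lambda>z. integral {0..pi} (\<lambda>x. sol (pencil v z (E z)) x * g x :: complex)) \<longlongrightarrow>
      integral {0..pi} (\<lambda>x. sol (pencil v 0 (E 0)) x * g x)) (at (0::complex))"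
proof -
  let ?f = "\<lambda>(z, \<mu>). integral {0..pi} (\<lambda>x. sol (pencil v z \<mu>) x * g x)"
  have "isCont ?f (0, E 0)"
    using continuous_on_weighted_sol_integral[OF assms(1,2)] by (simp add: continuous_on_eq_continuous_at)
  moreover have "((\<lambda>z. (z, E z)) \<longlongrightarrow> (0, E 0)) (at 0)"
    using E by (intro tendsto_Pair tendsto_ident_at) (simp add: isCont_def)
  ultimately have "((\<lambda>z. ?f (z, E z)) \<longlongrightarrow> ?f (0, E 0)) (at 0)"
    by (rule isCont_tendsto_compose)
  then show ?thesis by simp
qed

text \<open>A bound uniform in x bounds all \<open>potential_sine_coeff\<close> at once,
  independently of the index m; this is what dominates the perturbation series.\<close>

lemma eventually_sol_bounded:
  assumes v: "continuous_on {0..pi} v" and E: "isCont E 0"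
  obtains K where "0 \<le> K" "\<forall>\<^sub>F z in nhds 0. \<forall>x\<in>{0..pi}. norm (sol (pencil v z (E z)) x) \<le> K"
proof -
  let ?T = "cball (0::complex) 1 \<times> cball (E 0) 1 \<times> {0..pi}"
  have "bounded ((\<lambda>(z, \<mu>, x). sol (pencil v z \<mu>) x) ` ?T)"
    by (intro compact_imp_bounded compact_continuous_image compact_Times compact_cball compact_Icc
       continuous_on_subset[OF continuous_on_sol_pencil[OF v pi_ge_zero]]) auto
  then obtain K where K: "\<And>p. p \<in> ?T \<Longrightarrow> norm ((\<lambda>(z, \<mu>, x). sol (pencil v z \<mu>) x) p) \<le> K"
    unfolding bounded_iff by blast
  have "\<forall>\<^sub>F z in nhds 0. E z \<in> ball (E 0) 1"
    using E by (intro topological_tendstoD[of E "E 0"]) (auto simp: isCont_def tendsto_nhds_iff)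
  moreover have "\<forall>\<^sub>F z in nhds (0::complex). z \<in> ball 0 1"
    by (intro eventually_nhds_in_open) auto
  ultimately have ev: "\<forall>\<^sub>F z in nhds 0. \<forall>x\<in>{0..pi}. norm (sol (pencil v z (E z)) x) \<le> K"
  proof eventually_elim
    case (elim z)
    then show ?case using K[of "(z, E z, _)"] by auto
  qed
  moreover have "0 \<le> K" using order_trans[OF norm_ge_zero K[of "(0, E 0, 0)"]] by simp
  ultimately show ?thesis using that by blast
qed

lemma norm_potential_sine_coeff_le:
  assumes v: "continuous_on {0..pi} v" "\<And>x. x \<in> {0..pi} \<Longrightarrow> \<bar>v x\<bar> \<le> V"
    and K: "\<And>x. x \<in> {0..pi} \<Longrightarrow> norm (sol (pencil v z \<mu>) x) \<le> K"
  shows "norm (potential_sine_coeff v m z \<mu>) \<le> V * K * pi"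
proof -
  have "norm (potential_sine_coeff v m z \<mu>) \<le> V * K * (pi - 0)"
    unfolding potential_sine_coeff_def
  proof (rule integral_bound)
    fix x assume x: "x \<in> {0..pi}"
    have "norm (of_real (v x) * (sol (pencil v z \<mu>) x * of_real (sin (of_int m * x))))
        = \<bar>v x\<bar> * (norm (sol (pencil v z \<mu>) x) * \<bar>sin (of_int m * x)\<bar>)"
      by (simp add: norm_mult)
    also have "\<dots> \<le> V * (K * 1)"
      using order_trans[OF abs_ge_zero v(2)[OF x]] order_trans[OF norm_ge_zero K[OF x]]
      by (intro mult_mono v(2) K x abs_sin_le_one) auto
    finally show "norm (of_real (v x) * (sol (pencil v z \<mu>) x * of_real (sin (of_int m * x)))) \<le> V * K" by simp
  qed (auto intro!: continuous_intros v continuous_on_sol continuous_on_pencil)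
  then show ?thesis by simp
qed

lemma sine_coeff_free:
  assumes "n \<ge> 1"
  shows "sine_coeff v (int n) 0 ((of_nat n)\<^sup>2) = of_real (pi / (2 * real n))"
proof -
  have "((\<lambda>x. complex_of_real ((cos (2 * of_int 0 * x) - cos (2 * of_int (int n) * x)) / 2 / real n)) has_integral
      of_real (((if (0::int) = 0 then pi else 0) - (if int n = 0 then pi else 0)) / 2 / real n)) {0..pi}"
    by (intro has_integral_of_real has_integral_divide has_integral_diff has_integral_cos_even)
  moreover have "complex_of_real ((cos (2 * of_int 0 * x) - cos (2 * of_int (int n) * x)) / 2 / real n)
      = sol (pencil v 0 ((of_nat n)\<^sup>2)) x * of_real (sin (of_int (int n) * x))" if "x \<in> {0..pi}" for x
  proof -
    have "(cos (2 * of_int 0 * x) - cos (2 * of_int (int n) * x)) / 2 / real n = sin (real n * x) / real n * sin (of_int (int n) * x)"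
    proof -
      have "sin (real n * x) * sin (real n * x) = (1 - cos (2 * real n * x)) / 2"
        using sin_times_sin[of "real n * x" "real n * x"] by (simp add: mult_ac)
      from arg_cong[OF this, of "\<lambda>t. t / real n"] show ?thesis by simp
    qed
    then show ?thesis using sol_free_nat[OF assms, of x v] that by simp
  qed
  ultimately have "((\<lambda>x. sol (pencil v 0 ((of_nat n)\<^sup>2)) x * of_real (sin (of_int (int n) * x))) has_integral
      of_real (((if (0::int) = 0 then pi else 0) - (if int n = 0 then pi else 0)) / 2 / real n)) {0..pi}"
    by (rule has_integral_eq[rotated])
  then show ?thesis using assms by (simp add: sine_coeff_def integral_unique field_simps)
qed

context
  fixes a :: "nat \<Rightarrow> real" and \<sigma> :: real
  assumes \<sigma>: "(\<lambda>k. \<bar>a (Suc k)\<bar>) sums \<sigma>"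
begin

text \<open>At z = 0 the solution is sin(n x) / n, and the product-to-sum formula turns its product
  with sin((n + 2j) x) into a difference of two cosines. Hence the difference of two coefficients of
  v; j may be negative.\<close>

lemma potential_sine_coeff_free:
  assumes "n \<ge> 1"
  shows "potential_sine_coeff (cosine_potential a) (int n + 2 * j) 0 ((of_nat n)\<^sup>2)
    = of_real (pi / (2 * real n) / sqrt 2 * (even_coeff a j - even_coeff a (int n + j)))"
proof -
  let ?v = "cosine_potential a"
  have c: "((\<lambda>x. of_real (?v x) * complex_of_real (cos (2 * of_int j * x))) has_integral
     of_real (pi / sqrt 2 * even_coeff a j)) {0..pi}" for j
    unfolding cosine_potential_coeff[OF \<sigma>, symmetric]
    by (intro integrable_integral integrable_continuous_real continuous_intros continuous_on_cosine_potential[OF \<sigma>])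
  have "((\<lambda>x. (of_real (?v x) * complex_of_real (cos (2 * of_int j * x)) - of_real (?v x) * complex_of_real (cos (2 * of_int (int n + j) * x)))
       / (2 * of_nat n)) has_integral
     (of_real (pi / sqrt 2 * even_coeff a j) - of_real (pi / sqrt 2 * even_coeff a (int n + j))) / (2 * of_nat n)) {0..pi}"
    by (intro has_integral_divide has_integral_diff c)
  moreover have "(of_real (?v x) * complex_of_real (cos (2 * of_int j * x)) - of_real (?v x) * complex_of_real (cos (2 * of_int (int n + j) * x)))
       / (2 * of_nat n) = of_real (?v x) * (sol (pencil ?v 0 ((of_nat n)\<^sup>2)) x * of_real (sin (of_int (int n + 2 * j) * x)))"
    if "x \<in> {0..pi}" for x
  proof -
    have "sin (of_int (int n + 2 * j) * x) * sin (real n * x) = (cos (2 * of_int j * x) - cos (2 * of_int (int n + j) * x)) / 2"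
      unfolding sin_times_sin by (simp add: algebra_simps)
    then have "sin (real n * x) / real n * sin (of_int (int n + 2 * j) * x) =
        (cos (2 * of_int j * x) - cos (2 * of_int (int n + j) * x)) / (2 * real n)"
      using assms by (simp add: field_simps)
    then have "of_real (sin (real n * x) / real n) * of_real (sin (of_int (int n + 2 * j) * x)) =
        complex_of_real ((cos (2 * of_int j * x) - cos (2 * of_int (int n + j) * x)) / (2 * real n))"
      by (simp only: flip: of_real_mult)
    then show ?thesis using sol_free_nat[OF assms, of x ?v] that
      by (simp add: right_diff_distrib diff_divide_distrib)
  qed
  ultimately have "((\<lambda>x. of_real (?v x) * (sol (pencil ?v 0 ((of_nat n)\<^sup>2)) x * of_real (sin (of_int (int n + 2 * j) * x)))) has_integral
     (of_real (pi / sqrt 2 * even_coeff a j) - of_real (pi / sqrt 2 * even_coeff a (int n + j))) / (2 * of_nat n)) {0..pi}"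
    by (rule has_integral_eq[rotated])
  then show ?thesis by (simp add: potential_sine_coeff_def integral_unique right_diff_distrib diff_divide_distrib mult_ac)
qed

text \<open>Multiplying sin(m x) by cos(2k x) averages the indices m + 2k and m - 2k, so the k-th
  mode of v couples m with just these two.\<close>

lemma potential_sine_coeff_sums:
  "(\<lambda>k. of_real (a (Suc k) / sqrt 2) * (sine_coeff (cosine_potential a) (m + 2 * int (Suc k)) z \<mu>
        + sine_coeff (cosine_potential a) (m - 2 * int (Suc k)) z \<mu>))
   sums potential_sine_coeff (cosine_potential a) m z \<mu>"
proof -
  let ?v = "cosine_potential a"
  let ?s = "sol (pencil ?v z \<mu>)"
  have q: "continuous_on {0..pi} (pencil ?v z \<mu>)"
    by (intro continuous_on_pencil continuous_on_cosine_potential[OF \<sigma>])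
  have "(\<lambda>k. of_real (a (Suc k) * sqrt 2) * integral {0..pi} (\<lambda>x. of_real (cos (2 * real (Suc k) * x)) * (?s x * of_real (sin (of_int m * x)))))
    sums potential_sine_coeff ?v m z \<mu>"
    unfolding potential_sine_coeff_def
    by (intro cosine_potential_integral_sums[OF \<sigma>] continuous_intros continuous_on_sol q)
  moreover have "integral {0..pi} (\<lambda>x. of_real (cos (2 * real (Suc k) * x)) * (?s x * of_real (sin (of_int m * x))))
      = (sine_coeff ?v (m + 2 * int (Suc k)) z \<mu> + sine_coeff ?v (m - 2 * int (Suc k)) z \<mu>) / 2" for k
  proof (rule integral_unique)
    have "((\<lambda>x. (?s x * of_real (sin (of_int (m + 2 * int (Suc k)) * x)) + ?s x * of_real (sin (of_int (m - 2 * int (Suc k)) * x))) / 2) has_integral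
       (sine_coeff ?v (m + 2 * int (Suc k)) z \<mu> + sine_coeff ?v (m - 2 * int (Suc k)) z \<mu>) / 2) {0..pi}"
      unfolding sine_coeff_def
      by (intro has_integral_divide has_integral_add integrable_integral integrable_continuous_real
          continuous_intros continuous_on_sol q)
    moreover have "(?s x * of_real (sin (of_int (m + 2 * int (Suc k)) * x)) + ?s x * of_real (sin (of_int (m - 2 * int (Suc k)) * x))) / 2
        = of_real (cos (2 * real (Suc k) * x)) * (?s x * of_real (sin (of_int m * x)))" for x
    proof -
      have "sin (of_int m * x) * cos (2 * real (Suc k) * x) = (sin (of_int (m + 2 * int (Suc k)) * x) + sin (of_int (m - 2 * int (Suc k)) * x)) / 2"
        unfolding sin_times_cos by (simp add: algebra_simps)
      then have "complex_of_real (sin (of_int m * x)) * of_real (cos (2 * real (Suc k) * x)) = (of_real (sin (of_int (m + 2 * int (Suc k)) * x)) + of_real (sin (of_int (m - 2 * int (Suc k)) * x))) / 2"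
        by (simp only: flip: of_real_mult) simp
      then have "?s x * (complex_of_real (sin (of_int m * x)) * of_real (cos (2 * real (Suc k) * x)))
          = ?s x * ((of_real (sin (of_int (m + 2 * int (Suc k)) * x)) + of_real (sin (of_int (m - 2 * int (Suc k)) * x))) / 2)"
        by (simp only:)
      then show ?thesis by (simp add: distrib_left mult_ac)
    qed
    ultimately show "((\<lambda>x. of_real (cos (2 * real (Suc k) * x)) * (?s x * of_real (sin (of_int m * x)))) has_integral
       (sine_coeff ?v (m + 2 * int (Suc k)) z \<mu> + sine_coeff ?v (m - 2 * int (Suc k)) z \<mu>) / 2) {0..pi}"
      by (simp only:)
  qed
  moreover have "complex_of_real (a (Suc k) * sqrt 2) * (b / 2) = of_real (a (Suc k) / sqrt 2) * b" for k b
  proof -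
    have "a (Suc k) * sqrt 2 / 2 = a (Suc k) / sqrt 2" by (simp add: field_simps)
    then show ?thesis by (metis (no_types) of_real_divide of_real_numeral times_divide_eq_left times_divide_eq_right)
  qed
  ultimately show ?thesis by (simp only:)
qed

end

section \<open>Second-order perturbation theory\<close>

text \<open>At \<open>k = n\<close> the first quotient has denominator \<open>0\<close> and hence counts as \<open>0\<close>, as it should: this
  is where \<open>n - 2 k = - n\<close>, which carries no off-diagonal contribution.\<close>

definition second_order_term :: "(nat \<Rightarrow> real) \<Rightarrow> nat \<Rightarrow> nat \<Rightarrow> real" where
  "second_order_term a n k = a k / real k *
     ((a k - even_coeff a (int n - int k)) / (real n - real k)
      - (a k - even_coeff a (int n + int k)) / (real n + real k))"

text \<open>Distinct squares of integers differ by at least 1. This keeps the denominators of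
  perturbation theory away from 0 uniformly in m.\<close>

lemma norm_square_diff_ge:
  assumes "m \<noteq> int n" "m \<noteq> - int n" "norm (\<mu> - (of_nat n)\<^sup>2) \<le> 1 / 2"
  shows "1 / 2 \<le> norm ((of_int m)\<^sup>2 - \<mu> :: complex)"
proof -
  have "m\<^sup>2 \<noteq> (int n)\<^sup>2" using assms(1,2) by (simp add: power2_eq_iff)
  then have "1 \<le> \<bar>m\<^sup>2 - (int n)\<^sup>2\<bar>" by linarith
  then have "1 \<le> \<bar>real_of_int (m\<^sup>2 - (int n)\<^sup>2)\<bar>" by linarith
  also have "\<dots> = norm (of_int (m\<^sup>2 - (int n)\<^sup>2) :: complex)" by (simp only: norm_of_int)
  also have "of_int (m\<^sup>2 - (int n)\<^sup>2) = ((of_int m)\<^sup>2 - \<mu>) + (\<mu> - (of_nat n)\<^sup>2 :: complex)" by simp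
  also have "norm \<dots> \<le> norm ((of_int m)\<^sup>2 - \<mu>) + norm (\<mu> - (of_nat n)\<^sup>2)" by (rule norm_triangle_ineq)
  finally show ?thesis using assms(3) by linarith
qed

context
  fixes a :: "nat \<Rightarrow> real" and \<sigma> :: real
  assumes \<sigma>: "(\<lambda>k. \<bar>a (Suc k)\<bar>) sums \<sigma>"
begin

text \<open>With b_m and W_m the sine coefficients of the solution and of v times it, (E - n^2) b_n
  = z W_n, and W_n expands into b_(n+2k) and b_(n-2k). At k = n the index n - 2k = - n returns -
  b_n, which yields the first-order term - a_n / sqrt 2. Every other b_m is z W_m / (E - m^2).
  Dividing by z^2 b_n and letting z tend to 0 under the sum needs only continuity of E at 0.\<close>

lemma eigenvalue_second_order:
  fixes E :: "complex \<Rightarrow> complex" and n :: nat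
  assumes n: "n \<ge> 1" and E: "isCont E 0" "E 0 = (of_nat n)\<^sup>2"
    and ev: "\<forall>\<^sub>F z in nhds 0. sol (pencil (cosine_potential a) z (E z)) pi = 0"
  shows "summable (\<lambda>k. second_order_term a n (Suc k))"
    and "((\<lambda>z. ((E z - (of_nat n)\<^sup>2) / z + of_real (a n / sqrt 2)) / z) \<longlongrightarrow>
           of_real ((\<Sum>k. second_order_term a n (Suc k)) / 8)) (at 0)"
proof -
  let ?v = "cosine_potential a"
  define \<beta> where "\<beta> = pi / (2 * real n)"
  have \<beta>: "\<beta> > 0" using n by (simp add: \<beta>_def)
  define b where "b m z = sine_coeff ?v m z (E z)" for m z
  define W where "W m z = potential_sine_coeff ?v m z (E z)" for m z
  have v: "continuous_on S ?v" for S by (rule continuous_on_cosine_potential[OF \<sigma>])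
  have E_lim: "(E \<longlongrightarrow> (of_nat n)\<^sup>2) (at 0)" using E by (simp add: isCont_def)
  have b_lim: "(b (int n) \<longlongrightarrow> of_real \<beta>) (at 0)"
  proof -
    have "continuous_on {0..pi} (\<lambda>x. complex_of_real (sin (of_int (int n) * x)))"
      by (intro continuous_intros)
    from tendsto_weighted_sol_integral[OF v this E(1)] show ?thesis
      using sine_coeff_free[OF n, of ?v]
      unfolding b_def[abs_def] sine_coeff_def \<beta>_def E(2) by (simp only:)
  qed
  have W_lim: "(W (int n + 2 * j) \<longlongrightarrow> of_real (\<beta> / sqrt 2 * (even_coeff a j - even_coeff a (int n + j)))) (at 0)" for j
  proof -
    have "continuous_on {0..pi} (\<lambda>x. of_real (?v x) * complex_of_real (sin (of_int (int n + 2 * j) * x)))"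
      by (intro continuous_intros v)
    from tendsto_weighted_sol_integral[OF v this E(1)] show ?thesis
      using potential_sine_coeff_free[OF \<sigma> n, of j]
      unfolding W_def[abs_def] potential_sine_coeff_def \<beta>_def E(2) by (simp only: mult.left_commute)
  qed
  obtain K where K: "0 \<le> K" "\<forall>\<^sub>F z in nhds 0. \<forall>x\<in>{0..pi}. norm (sol (pencil ?v z (E z)) x) \<le> K"
    using eventually_sol_bounded[OF v E(1)] by blast
  define KW where "KW = sqrt 2 * \<sigma> * K * pi"
  \<comment> \<open>The k-th term after division by z b_n, with the off-diagonal coefficients
    rewritten by \<open>sine_coeff_eq\<close>. The index - n is left out, since its denominator n^2
    - E tends to 0.\<close>
  define summand where "summand k z = of_real (a k / sqrt 2) *
      (- W (int n + 2 * int k) z / ((of_int (int n + 2 * int k))\<^sup>2 - E z)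
       + (if k = n then 0 else - W (int n + 2 * - int k) z / ((of_int (int n + 2 * - int k))\<^sup>2 - E z))) / b (int n) z"
    for k z
  have close: "\<forall>\<^sub>F z in at 0. norm (E z - (of_nat n)\<^sup>2) < 1 / 2"
    using tendstoD[OF E_lim, of "1 / 2"] by (simp add: dist_norm)
  have "\<forall>\<^sub>F z in at 0. dist (b (int n) z) (of_real \<beta>) < \<beta> / 2"
    using tendstoD[OF b_lim, of "\<beta> / 2"] \<beta> by simp
  then have b_ge: "\<forall>\<^sub>F z in at 0. \<beta> / 2 \<le> norm (b (int n) z)"
  proof eventually_elim
    case (elim z)
    have "norm (of_real \<beta> :: complex) \<le> norm (b (int n) z) + norm (of_real \<beta> - b (int n) z)"
      by (rule norm_triangle_sub)
    then show ?case using elim \<beta> by (simp add: dist_norm norm_minus_commute)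
  qed
  have W_le: "\<forall>\<^sub>F z in at 0. \<forall>m. norm (W m z) \<le> KW"
  proof (rule eventually_mono)
    show "\<forall>\<^sub>F z in at 0. \<forall>x\<in>{0..pi}. norm (sol (pencil ?v z (E z)) x) \<le> K"
      using K(2) by (rule filter_leD[OF at_within_le_nhds])
    show "\<forall>m. norm (W m z) \<le> KW" if "\<forall>x\<in>{0..pi}. norm (sol (pencil ?v z (E z)) x) \<le> K" for z
      unfolding W_def KW_def using that
      by (intro allI norm_potential_sine_coeff_le v abs_cosine_potential_le[OF \<sigma>]) auto
  qed
  have ev': "\<forall>\<^sub>F z in at 0. sol (pencil ?v z (E z)) pi = 0"
    using ev by (rule filter_leD[OF at_within_le_nhds])
  have ne: "int n + 2 * int (Suc k) \<noteq> int n" "int n + 2 * int (Suc k) \<noteq> - int n"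
    "int n + 2 * - int (Suc k) \<noteq> int n" "Suc k \<noteq> n \<Longrightarrow> int n + 2 * - int (Suc k) \<noteq> - int n" for k
    using n by auto
  have eq: "\<forall>\<^sub>F z in at 0. ((E z - (of_nat n)\<^sup>2) / z + of_real (a n / sqrt 2)) / z = (\<Sum>k. summand (Suc k) z)"
    using ev' close b_ge eventually_neq_at_within[of 0 0]
  proof eventually_elim
    case (elim z)
    have bn: "b (int n) z \<noteq> 0" using elim(3) \<beta> by auto
    have beq: "((of_int m)\<^sup>2 - E z) * b m z = - z * W m z" for m
      unfolding b_def W_def by (rule sine_coeff_eq[OF v elim(1)])
    have bm: "b m z = z * (- W m z / ((of_int m)\<^sup>2 - E z))" if "m \<noteq> int n" "m \<noteq> - int n" for m
    proof -
      have "(of_int m)\<^sup>2 - E z \<noteq> 0"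
        using norm_square_diff_ge[OF that, of "E z"] elim(2) by auto
      moreover have "z * (- W m z / ((of_int m)\<^sup>2 - E z)) = ((of_int m)\<^sup>2 - E z) * b m z / ((of_int m)\<^sup>2 - E z)"
        unfolding beq[of m] by simp
      ultimately show ?thesis by simp
    qed
    have cancel: "z * b (int n) z * (c * s / b (int n) z) = c * (z * s)" for c s
      using bn by simp
    have "(\<lambda>k. of_real (a (Suc k) / sqrt 2) * (b (int n + 2 * int (Suc k)) z + b (int n + 2 * - int (Suc k)) z))
      sums W (int n) z"
      using potential_sine_coeff_sums[OF \<sigma>, of "int n" z "E z"]
      unfolding b_def W_def mult_minus_right add_uminus_conv_diff .
    \<comment> \<open>A one-term series takes out the coupling to - n. It sits at position n - 1
      because the series starts with a_1.\<close>
    moreover have "(\<lambda>k. if k = n - 1 then of_real (a (Suc k) / sqrt 2) * b (- int n) z else 0)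
      sums (of_real (a (Suc (n - 1)) / sqrt 2) * b (- int n) z)"
      by (rule sums_single)
    ultimately have "(\<lambda>k. of_real (a (Suc k) / sqrt 2) * (b (int n + 2 * int (Suc k)) z + b (int n + 2 * - int (Suc k)) z)
        - (if k = n - 1 then of_real (a (Suc k) / sqrt 2) * b (- int n) z else 0))
      sums (W (int n) z - of_real (a (Suc (n - 1)) / sqrt 2) * b (- int n) z)"
      by (rule sums_diff)
    also have "(\<lambda>k. of_real (a (Suc k) / sqrt 2) * (b (int n + 2 * int (Suc k)) z + b (int n + 2 * - int (Suc k)) z)
        - (if k = n - 1 then of_real (a (Suc k) / sqrt 2) * b (- int n) z else 0))
      = (\<lambda>k. z * b (int n) z * summand (Suc k) z)"
    proof
      fix k
      show "of_real (a (Suc k) / sqrt 2) * (b (int n + 2 * int (Suc k)) z + b (int n + 2 * - int (Suc k)) z)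
        - (if k = n - 1 then of_real (a (Suc k) / sqrt 2) * b (- int n) z else 0) = z * b (int n) z * summand (Suc k) z"
      proof (cases "Suc k = n")
        case True
        then have "int n + 2 * - int (Suc k) = - int n" "k = n - 1" by auto
        then show ?thesis
          unfolding summand_def cancel if_P[OF True] bm[OF ne(1,2)[of k]]
          by (simp only: distrib_left simp_thms if_True add_diff_cancel_right' add_0_right)
      next
        case False
        then have "k \<noteq> n - 1" using n by auto
        then show ?thesis
          unfolding summand_def cancel if_not_P[OF False] bm[OF ne(1,2)[of k]] bm[OF ne(3) ne(4)[OF False]]
          by (simp only: distrib_left if_False diff_zero)
      qed
    qed
    also have "W (int n) z - of_real (a (Suc (n - 1)) / sqrt 2) * b (- int n) z
        = z * b (int n) z * (((E z - (of_nat n)\<^sup>2) / z + of_real (a n / sqrt 2)) / z)"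
    proof -
      have "b (- int n) z = - b (int n) z" by (simp add: b_def sine_coeff_minus)
      moreover have "W (int n) z = (E z - (of_nat n)\<^sup>2) * b (int n) z / z"
        using beq[of "int n"] elim(4) by (simp add: field_simps)
      moreover have "e * B / z - c * - B = z * B * ((e / z + c) / z)" for e B c
        using elim(4) by (simp add: field_simps)
      moreover have "Suc (n - 1) = n" using n by simp
      ultimately show ?thesis by (simp only:)
    qed
    finally have "(\<lambda>k. summand (Suc k) z) sums (((E z - (of_nat n)\<^sup>2) / z + of_real (a n / sqrt 2)) / z)"
      using bn elim(4) by (subst (asm) sums_mult_iff) auto
    then show ?case by (rule sums_unique)
  qed
  have lim: "(summand (Suc k) \<longlongrightarrow> of_real (second_order_term a n (Suc k) / 8)) (at 0)" for k
  proof -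
    define k' where "k' = Suc k"
    have k': "k' \<ge> 1" by (simp add: k'_def)
    \<comment> \<open>The 4 in this factorisation and the two factors sqrt 2, from the coupling
      weight and from the matrix element, make up the 8 in the limit; \<beta> cancels.\<close>
    have sq: "(of_int (int n + 2 * j))\<^sup>2 - (of_nat n)\<^sup>2 = (of_int (4 * j * (int n + j)) :: complex)" for j
      by (simp add: power2_eq_square algebra_simps)
    have 1: "((\<lambda>z. - W (int n + 2 * j) z / ((of_int (int n + 2 * j))\<^sup>2 - E z)) \<longlongrightarrow>
        - of_real (\<beta> / sqrt 2 * (even_coeff a j - even_coeff a (int n + j))) / of_int (4 * j * (int n + j))) (at 0)"
      if "j \<noteq> 0" "int n + j \<noteq> 0" for j
    proof (rule tendsto_divide[OF tendsto_minus[OF W_lim]])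
      show "((\<lambda>z. (of_int (int n + 2 * j))\<^sup>2 - E z) \<longlongrightarrow> of_int (4 * j * (int n + j))) (at 0)"
        unfolding sq[symmetric] by (intro tendsto_diff tendsto_const E_lim)
      show "complex_of_int (4 * j * (int n + j)) \<noteq> 0"
        unfolding of_int_eq_0_iff using that by simp
    qed
    have 2: "((\<lambda>z. if k' = n then 0 else - W (int n + 2 * - int k') z / ((of_int (int n + 2 * - int k'))\<^sup>2 - E z)) \<longlongrightarrow>
        (if k' = n then 0 else - of_real (\<beta> / sqrt 2 * (even_coeff a (- int k') - even_coeff a (int n + - int k'))) / of_int (4 * - int k' * (int n + - int k')))) (at 0)"
    proof (cases "k' = n")
      case False
      then show ?thesis
        unfolding if_not_P[OF False] by (intro 1) (use k' in auto)
    qed simp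
    have "(summand k' \<longlongrightarrow> of_real (a k' / sqrt 2) *
      (- of_real (\<beta> / sqrt 2 * (even_coeff a (int k') - even_coeff a (int n + int k'))) / of_int (4 * int k' * (int n + int k'))
       + (if k' = n then 0 else - of_real (\<beta> / sqrt 2 * (even_coeff a (- int k') - even_coeff a (int n + - int k'))) / of_int (4 * - int k' * (int n + - int k')))) / of_real \<beta>) (at 0)"
      unfolding summand_def[abs_def]
      by (rule tendsto_divide[OF tendsto_mult[OF tendsto_const tendsto_add[OF 1 2]] b_lim]) (use k' n \<beta> in auto)
    also have "of_real (a k' / sqrt 2) *
      (- of_real (\<beta> / sqrt 2 * (even_coeff a (int k') - even_coeff a (int n + int k'))) / of_int (4 * int k' * (int n + int k'))
       + (if k' = n then 0 else - of_real (\<beta> / sqrt 2 * (even_coeff a (- int k') - even_coeff a (int n + - int k'))) / of_int (4 * - int k' * (int n + - int k')))) / of_real \<beta>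
      = complex_of_real (a k' / sqrt 2 *
      (- (\<beta> / sqrt 2 * (even_coeff a (int k') - even_coeff a (int n + int k'))) / of_int (4 * int k' * (int n + int k'))
       + (if k' = n then 0 else - (\<beta> / sqrt 2 * (even_coeff a (- int k') - even_coeff a (int n + - int k'))) / of_int (4 * - int k' * (int n + - int k')))) / \<beta>)"
      by simp
    also have "a k' / sqrt 2 *
      (- (\<beta> / sqrt 2 * (even_coeff a (int k') - even_coeff a (int n + int k'))) / of_int (4 * int k' * (int n + int k'))
       + (if k' = n then 0 else - (\<beta> / sqrt 2 * (even_coeff a (- int k') - even_coeff a (int n + - int k'))) / of_int (4 * - int k' * (int n + - int k')))) / \<beta>
      = second_order_term a n k' / 8"
    proof -
      have ak: "even_coeff a (int k') = a k'" "even_coeff a (- int k') = a k'"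
        using k' by (auto simp: even_coeff_def)
      have alg: "A / r * (- (\<beta> / r * X) / (4 * k * p) + - (\<beta> / r * Y) / (4 * - k * q)) / \<beta> = A / k * (Y / q - X / p) / 8"
        if "r * r = 2" "k \<noteq> 0" "p \<noteq> 0" "q \<noteq> 0" for A r X Y k p q :: real
      proof -
        have r: "r \<noteq> 0" using that by auto
        have "A / r * (- (\<beta> / r * X) / (4 * k * p) + - (\<beta> / r * Y) / (4 * - k * q)) / \<beta>
           = A / (r * r) * (- X / (4 * k * p) + Y / (4 * k * q))"
          using \<beta> r that(2-) by (simp add: field_simps)
        then show ?thesis using that by (simp add: field_simps)
      qed
      show ?thesis
      proof (cases "k' = n")
        case True
        have "A / r * (- (\<beta> / r * X) / (4 * k * p) + 0) / \<beta> = A / k * (0 - X / p) / 8"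
          if "r * r = 2" "k \<noteq> 0" "p \<noteq> 0" for A r X k p :: real
          using alg[OF that(1,2,3), of 1 A X 0] by simp
        from this[of "sqrt 2" "real k'" "real n + real k'"] show ?thesis
          using True k' ak unfolding second_order_term_def by simp
      next
        case False
        then have "real n + - real k' \<noteq> 0" by simp
        from alg[OF _ _ _ this, of "sqrt 2" "real k'" "real n + real k'"] show ?thesis
          using False k' ak unfolding second_order_term_def by simp
      qed
    qed
    finally show ?thesis by (simp add: k'_def)
  qed
  \<comment> \<open>The dominating sequence for Tannery's theorem: the gap 1/2 bounds each of the
    two quotients by 2 KW, and b_n is at least \<beta> / 2.\<close>
  have bound: "\<forall>\<^sub>F z in at 0. \<forall>k. norm (summand (Suc k) z) \<le> \<bar>a (Suc k)\<bar> * (8 * KW / \<beta>)"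
    using close b_ge W_le
  proof eventually_elim
    case (elim z)
    show ?case
    proof
      fix k
      have KW: "0 \<le> KW" using elim(3) order_trans[OF norm_ge_zero] by blast
      have 1: "norm (- W m z / ((of_int m)\<^sup>2 - E z)) \<le> KW / (1 / 2)" if "m \<noteq> int n" "m \<noteq> - int n" for m
        unfolding norm_divide norm_minus_cancel
        by (rule frac_le) (use elim norm_square_diff_ge[OF that, of "E z"] KW in auto)
      have 2: "norm (if Suc k = n then 0 else - W (int n + 2 * - int (Suc k)) z / ((of_int (int n + 2 * - int (Suc k)))\<^sup>2 - E z)) \<le> KW / (1 / 2)"
        using 1[OF ne(3,4)[of k]] KW by auto
      have "norm (summand (Suc k) z) \<le> (\<bar>a (Suc k)\<bar> * (KW / (1 / 2) + KW / (1 / 2))) / (\<beta> / 2)"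
        unfolding summand_def norm_divide norm_mult
      proof (intro frac_le mult_mono)
        show "norm (complex_of_real (a (Suc k) / sqrt 2)) \<le> \<bar>a (Suc k)\<bar>"
          unfolding norm_of_real
          using frac_le[of "\<bar>a (Suc k)\<bar>" "\<bar>a (Suc k)\<bar>" 1 "sqrt 2"] by (simp add: abs_divide)
        show "norm (- W (int n + 2 * int (Suc k)) z / ((of_int (int n + 2 * int (Suc k)))\<^sup>2 - E z)
           + (if Suc k = n then 0 else - W (int n + 2 * - int (Suc k)) z / ((of_int (int n + 2 * - int (Suc k)))\<^sup>2 - E z)))
           \<le> KW / (1 / 2) + KW / (1 / 2)"
          by (rule order_trans[OF norm_triangle_ineq add_mono[OF 1[OF ne(1,2)[of k]] 2]])
      qed (use elim \<beta> KW in auto)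
      then show "norm (summand (Suc k) z) \<le> \<bar>a (Suc k)\<bar> * (8 * KW / \<beta>)" by (simp add: mult_ac)
    qed
  qed
  have "\<forall>\<^sub>F (k, z) in at_top \<times>\<^sub>F at 0. norm (summand (Suc k) z) \<le> \<bar>a (Suc k)\<bar> * (8 * KW / \<beta>)"
    unfolding eventually_prod_filter using bound by (intro exI[of _ "\<lambda>_. True"] exI conjI) auto
  from tannerys_theorem[OF lim this summable_mult2[OF sums_summable[OF \<sigma>]]]
  have T: "summable (\<lambda>k. norm (complex_of_real (second_order_term a n (Suc k) / 8)))"
    "((\<lambda>z. \<Sum>k. summand (Suc k) z) \<longlongrightarrow> (\<Sum>k. of_real (second_order_term a n (Suc k) / 8))) (at 0)" by auto
  have s: "summable (\<lambda>k. second_order_term a n (Suc k) / 8)"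
    using T(1) unfolding norm_of_real by (rule summable_rabs_cancel)
  show s': "summable (\<lambda>k. second_order_term a n (Suc k))"
    using summable_mult[OF s, of 8] by simp
  have "(\<Sum>k. complex_of_real (second_order_term a n (Suc k) / 8)) = of_real ((\<Sum>k. second_order_term a n (Suc k)) / 8)"
    using suminf_of_real[OF s, where ?'a=complex] suminf_divide[OF s', of 8] by simp
  with T(2) show "((\<lambda>z. ((E z - (of_nat n)\<^sup>2) / z + of_real (a n / sqrt 2)) / z) \<longlongrightarrow>
           of_real ((\<Sum>k. second_order_term a n (Suc k)) / 8)) (at 0)"
    unfolding tendsto_cong[OF eq] by (simp only:)
qed

end

section \<open>A lower bound for the second-order coefficient\<close>

text \<open>The diagonal part is 2 a_k^2 / (n^2 - k^2) for k different from n: at least 2 a_k^2 /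
  n^2 when k < n, and of the wrong sign when k > n, but there k is so large that a_k itself is
  small. In each cross product some index is at least n/2, and its decay absorbs the weight. The
  error is linear in |a_k| and |a_(n-k)|, hence summable over k with a bound uniform in n; 9 and 4
  are convenient constants covering all cases.\<close>

lemma second_order_term_ge:
  assumes n: "n \<ge> 1" and k: "k \<ge> 1"
    and small: "\<And>j. j \<ge> 1 \<Longrightarrow> n \<le> 2 * j \<Longrightarrow> real j * \<bar>a j\<bar> \<le> \<epsilon>"
  shows "(real n)\<^sup>2 * second_order_term a n k
    \<ge> 2 * (a k)\<^sup>2 - \<epsilon> * (9 * \<bar>a k\<bar> + 4 * \<bar>even_coeff a (int n - int k)\<bar>)"
proof -
  let ?n = "real n" and ?k = "real k"
  define A where "A = a k"
  define B where "B = even_coeff a (int n - int k)"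
  define D where "D = a (n + k)"
  have n0: "?n \<ge> 1" and k0: "?k \<ge> 1" using n k by auto
  have eD: "even_coeff a (int n + int k) = D"
    using k by (simp add: even_coeff_def D_def nat_add_distrib)
  have T: "second_order_term a n k = A / ?k * ((A - B) / (?n - ?k) - (A - D) / (?n + ?k))"
    by (simp add: second_order_term_def A_def B_def eD)
  have D: "(?n + ?k) * \<bar>D\<bar> \<le> \<epsilon>" using small[of "n + k"] n by (simp add: D_def)
  have \<epsilon>: "0 \<le> \<epsilon>" using D by (rule order_trans[rotated]) (use n0 k0 in auto)
  have pos: "0 \<le> \<epsilon> * \<bar>A\<bar>" "0 \<le> \<epsilon> * \<bar>B\<bar>" using \<epsilon> by auto
  have crossD: "\<bar>?n\<^sup>2 * (A / ?k * (D / (?n + ?k)))\<bar> \<le> \<epsilon> * \<bar>A\<bar>"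
  proof -
    have "?n\<^sup>2 / (?k * (?n + ?k)) \<le> ?n + ?k"
    proof -
      have "?n\<^sup>2 \<le> (?n + ?k)\<^sup>2" using n0 k0 by (intro power_mono) auto
      also have "\<dots> \<le> ?k * (?n + ?k)\<^sup>2" using k0 by (intro mult_left_le_one_le[THEN order_trans] mult_le_cancel_right1[THEN iffD2]) auto
      finally show ?thesis using n0 k0 by (simp add: divide_le_eq power2_eq_square mult_ac)
    qed
    then have "\<bar>A\<bar> * (?n\<^sup>2 / (?k * (?n + ?k)) * \<bar>D\<bar>) \<le> \<bar>A\<bar> * ((?n + ?k) * \<bar>D\<bar>)"
      by (intro mult_left_mono mult_right_mono) auto
    also have "\<dots> \<le> \<bar>A\<bar> * \<epsilon>" by (intro mult_left_mono D) auto
    finally show ?thesis using n0 k0 by (simp add: abs_mult mult_ac)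
  qed
  have expand: "\<epsilon> * (9 * \<bar>A\<bar> + 4 * \<bar>B\<bar>) = 9 * (\<epsilon> * \<bar>A\<bar>) + 4 * (\<epsilon> * \<bar>B\<bar>)"
    "4 * \<epsilon> * (\<bar>A\<bar> + \<bar>B\<bar>) = 4 * (\<epsilon> * \<bar>A\<bar>) + 4 * (\<epsilon> * \<bar>B\<bar>)" by (simp_all add: algebra_simps)
  consider "k = n" | "k < n" | "k > n" by linarith
  then have "?n\<^sup>2 * second_order_term a n k \<ge> 2 * A\<^sup>2 - \<epsilon> * (9 * \<bar>A\<bar> + 4 * \<bar>B\<bar>)"
  proof cases
    case 1
    have A\<epsilon>: "\<bar>A\<bar> \<le> \<epsilon>"
      using small[of k] k 1 mult_right_mono[OF k0, of "\<bar>A\<bar>"] by (simp add: A_def)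
    have A2: "A\<^sup>2 \<le> \<epsilon> * \<bar>A\<bar>"
      using mult_right_mono[OF A\<epsilon>, of "\<bar>A\<bar>"] by (simp add: power2_eq_square)
    have "?n\<^sup>2 * second_order_term a n k = - (A\<^sup>2 / 2) + ?n\<^sup>2 * (A / ?k * (D / (?n + ?k)))"
      unfolding T using 1 n0 by (simp add: field_simps power2_eq_square)
    moreover have "2 * s - (9 * e + 4 * f) \<le> T" if "T = - (s / 2) + X" "- X \<le> e" "s \<le> e" "0 \<le> e" "0 \<le> f"
      for T X s e f :: real using that by linarith
    ultimately show ?thesis unfolding expand using abs_le_D2[OF crossD] A2 pos by blast
  next
    case 2
    define j where "j = n - k"
    have j: "j \<ge> 1" "?n - ?k = real j" "?n = ?k + real j" using 2 by (auto simp: j_def of_nat_diff)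
    have Bj: "B = a j" using 2 by (auto simp: B_def even_coeff_def j_def intro!: arg_cong[of _ _ a])
    have j0: "real j \<ge> 1" using j by simp
    have main: "2 * A\<^sup>2 \<le> ?n\<^sup>2 * (A / ?k * (A / real j - A / (?n + ?k)))"
    proof -
      have "A / ?k * (A / real j - A / (?n + ?k)) = A\<^sup>2 * (2 / (real j * (?n + ?k)))"
        using j j0 k0 n0 by (simp add: field_simps power2_eq_square)
      moreover have "?n\<^sup>2 / (real j * (?n + ?k)) \<ge> 1"
      proof -
        have "0 < real j * (?n + ?k)" using j0 k0 n0 by (intro mult_pos_pos) auto
        moreover have "real j * (?n + ?k) \<le> ?n\<^sup>2"
          using j(3) by (simp add: power2_eq_square algebra_simps)
        ultimately show ?thesis by (simp add: le_divide_eq)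
      qed
      then have "2 * A\<^sup>2 * 1 \<le> 2 * A\<^sup>2 * (?n\<^sup>2 / (real j * (?n + ?k)))"
        by (intro mult_left_mono) auto
      ultimately show ?thesis by (simp add: mult_ac)
    qed
    have crossB: "\<bar>?n\<^sup>2 * (A / ?k * (B / real j))\<bar> \<le> 4 * \<epsilon> * (\<bar>A\<bar> + \<bar>B\<bar>)"
    proof -
      \<comment> \<open>Here p is the index at least n/2: from n <= 2 p and q >= 1 the weight is at
        most 4 p, which the decay of p x absorbs.\<close>
      have *: "?n\<^sup>2 / (p * q) * x \<le> 4 * \<epsilon>" if "p \<ge> 1" "q \<ge> 1" "?n \<le> 2 * p" "p * x \<le> \<epsilon>" "0 \<le> x" for p q x :: real
      proof -
        have "?n\<^sup>2 \<le> (2 * p)\<^sup>2" using that by (intro power_mono) auto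
        then have "?n\<^sup>2 / (p * q) \<le> (2 * p)\<^sup>2 / (p * 1)"
          using that by (intro frac_le mult_mono) auto
        then have "?n\<^sup>2 / (p * q) * x \<le> (2 * p)\<^sup>2 / (p * 1) * x" using that by (intro mult_right_mono) auto
        also have "\<dots> = 4 * (p * x)" using that by (simp add: power2_eq_square)
        finally show ?thesis using that by linarith
      qed
      have eq: "\<bar>?n\<^sup>2 * (A / ?k * (B / real j))\<bar> = ?n\<^sup>2 / (?k * real j) * \<bar>A\<bar> * \<bar>B\<bar>"
        by (simp add: abs_mult)
      \<comment> \<open>Since k + j = n, one of k and j is at least n/2; the decay is applied to
        \<open>A\<close> in the first case and to \<open>B\<close> in the second.\<close>
      show ?thesis
      proof (cases "n \<le> 2 * k")
        case True
        have "?n\<^sup>2 / (?k * real j) * \<bar>A\<bar> \<le> 4 * \<epsilon>"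
          using True small[of k] k by (intro * k0 j0) (auto simp: A_def)
        from mult_right_mono[OF this, of "\<bar>B\<bar>"] show ?thesis
          unfolding eq using pos by (simp add: algebra_simps)
      next
        case False
        then have "n \<le> 2 * j" by (auto simp: j_def)
        then have "?n\<^sup>2 / (real j * ?k) * \<bar>B\<bar> \<le> 4 * \<epsilon>"
          using small[of j] j by (intro * k0 j0) (auto simp: Bj)
        from mult_right_mono[OF this, of "\<bar>A\<bar>"] show ?thesis
          unfolding eq using pos by (simp add: algebra_simps)
      qed
    qed
    have "?n\<^sup>2 * second_order_term a n k = ?n\<^sup>2 * (A / ?k * (A / real j - A / (?n + ?k)))
       - ?n\<^sup>2 * (A / ?k * (B / real j)) + ?n\<^sup>2 * (A / ?k * (D / (?n + ?k)))"
      unfolding T j(2) by (simp add: diff_divide_distrib algebra_simps)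
    moreover have "2 * s - (9 * e + 4 * f) \<le> T"
      if "T = Y - Z + X" "2 * s \<le> Y" "Z \<le> 4 * e + 4 * f" "- X \<le> e" "0 \<le> e" "0 \<le> f"
      for T X Y Z s e f :: real using that by linarith
    ultimately show ?thesis
      unfolding expand using main abs_le_D1[OF crossB[unfolded expand]] abs_le_D2[OF crossD] pos by blast
  next
    case 3
    define j where "j = k - n"
    have j: "j \<ge> 1" "?n - ?k = - real j" using 3 by (auto simp: j_def of_nat_diff)
    have j0: "real j \<ge> 1" using j by simp
    \<comment> \<open>Beyond n the coefficient \<open>A\<close> is always in the decaying range, and
      this one bound controls the diagonal part and the cross term with \<open>B\<close>.\<close>
    have kA: "?k * \<bar>A\<bar> \<le> \<epsilon>" using small[of k] k 3 by (simp add: A_def)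
    have A\<epsilon>: "\<bar>A\<bar> \<le> \<epsilon>" "?n * \<bar>A\<bar> \<le> \<epsilon>"
      using kA mult_right_mono[OF k0, of "\<bar>A\<bar>"] mult_right_mono[of ?n ?k "\<bar>A\<bar>"] 3 by auto
    have A2: "A\<^sup>2 \<le> \<epsilon> * \<bar>A\<bar>" "?n * A\<^sup>2 \<le> \<epsilon> * \<bar>A\<bar>"
      using mult_right_mono[OF A\<epsilon>(1), of "\<bar>A\<bar>"] mult_right_mono[OF A\<epsilon>(2), of "\<bar>A\<bar>"]
      by (simp_all add: power2_eq_square mult.assoc)
    have main: "?n\<^sup>2 * (A / ?k * (A / real j + A / (?n + ?k))) \<le> 2 * (\<epsilon> * \<bar>A\<bar>)"
    proof -
      have jk: "(?n + ?k) + real j = 2 * ?k" using 3 by (simp add: j_def of_nat_diff)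
      have "A / ?k * (A / real j + A / p) = A\<^sup>2 * ((p + real j) / (?k * (real j * p)))" if "p > 0" for p
        using that j0 k0 by (simp add: field_simps power2_eq_square)
      from this[of "?n + ?k"] have "A / ?k * (A / real j + A / (?n + ?k)) = A\<^sup>2 * (2 / (real j * (?n + ?k)))"
        using k0 n0 unfolding jk by simp
      moreover have "?n\<^sup>2 / (real j * (?n + ?k)) \<le> ?n\<^sup>2 / (1 * ?n)"
        using j0 k0 n0 by (intro divide_left_mono mult_mono) auto
      then have "2 * A\<^sup>2 * (?n\<^sup>2 / (real j * (?n + ?k))) \<le> 2 * A\<^sup>2 * ?n"
        using n0 by (intro mult_left_mono) (auto simp: power2_eq_square)
      ultimately show ?thesis using A2(2) by (simp add: mult_ac)
    qed
    have crossB: "\<bar>?n\<^sup>2 * (A / ?k * (B / real j))\<bar> \<le> \<epsilon> * \<bar>B\<bar>"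
    proof -
      have "?n\<^sup>2 \<le> ?k\<^sup>2" using 3 by (intro power_mono) auto
      then have "?n\<^sup>2 / (?k * real j) \<le> ?k\<^sup>2 / (?k * 1)"
        using k0 j0 by (intro frac_le mult_left_mono) auto
      then have "?n\<^sup>2 / (?k * real j) * \<bar>A\<bar> \<le> ?k * \<bar>A\<bar>"
        using k0 by (intro mult_right_mono) (auto simp: power2_eq_square)
      then have "?n\<^sup>2 / (?k * real j) * \<bar>A\<bar> \<le> \<epsilon>" using kA by linarith
      from mult_right_mono[OF this, of "\<bar>B\<bar>"] show ?thesis by (simp add: abs_mult)
    qed
    have "?n\<^sup>2 * second_order_term a n k = - (?n\<^sup>2 * (A / ?k * (A / real j + A / (?n + ?k))))
       + ?n\<^sup>2 * (A / ?k * (B / real j)) + ?n\<^sup>2 * (A / ?k * (D / (?n + ?k)))"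
      unfolding T j(2) by (simp add: diff_divide_distrib algebra_simps)
    moreover have "2 * s - (9 * e + 4 * f) \<le> T"
      if "T = - Y + Z + X" "Y \<le> 2 * e" "- Z \<le> f" "- X \<le> e" "s \<le> e" "0 \<le> e" "0 \<le> f"
      for T X Y Z s e f :: real using that by linarith
    ultimately show ?thesis
      unfolding expand using main abs_le_D2[OF crossB] abs_le_D2[OF crossD] A2(1) pos by blast
  qed
  then show ?thesis by (simp add: A_def B_def)
qed

text \<open>The indices k > n run through the whole sequence and contribute \<sigma>; those below n
  run through an initial segment backwards and contribute at most \<sigma>. The bound has to be
  uniform in n.\<close>

lemma reflected_coeff_sums:
  assumes \<sigma>: "(\<lambda>k. \<bar>a (Suc k)\<bar>) sums \<sigma>"
  obtains \<tau> where "(\<lambda>k. \<bar>even_coeff a (int n - int (Suc k))\<bar>) sums \<tau>" "\<tau> \<le> 2 * \<sigma>"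
proof -
  let ?c = "\<lambda>k. \<bar>even_coeff a (int n - int (Suc k))\<bar>"
  have "?c (k + n) = \<bar>a (Suc k)\<bar>" for k by (simp add: even_coeff_def nat_add_distrib)
  then have "(\<lambda>k. ?c (k + n)) sums \<sigma>" using \<sigma> by simp
  then have s: "?c sums (\<sigma> + (\<Sum>k<n. ?c k))" by (rule sums_iff_shift[THEN iffD1])
  have "(\<Sum>k<n. ?c k) = (\<Sum>k<n. \<bar>even_coeff a (int (n - Suc k))\<bar>)"
    by (intro sum.cong) (auto simp: of_nat_diff)
  also have "\<dots> = (\<Sum>k<n. \<bar>even_coeff a (int k)\<bar>)"
    by (rule sum.nat_diff_reindex)
  also have "\<dots> \<le> (\<Sum>k<Suc n. \<bar>even_coeff a (int k)\<bar>)" by simp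
  also have "\<dots> = (\<Sum>k<n. \<bar>a (Suc k)\<bar>)"
    by (subst sum.lessThan_Suc_shift) (simp add: even_coeff_def nat_add_distrib)
  also have "\<dots> \<le> \<sigma>"
    using sum_le_suminf[OF sums_summable[OF \<sigma>], of "{..<n}"] sums_unique[OF \<sigma>] by simp
  finally show ?thesis using that[OF s] by simp
qed

lemma eventually_second_order_ge:
  assumes \<sigma>: "(\<lambda>k. \<bar>a (Suc k)\<bar>) sums \<sigma>" and N: "(\<lambda>k. (a (Suc k))\<^sup>2) sums N" "N > 0"
    and decay: "(\<lambda>k. real k * a k) \<longlonglongrightarrow> 0"
  shows "\<forall>\<^sub>F n in sequentially. summable (\<lambda>k. second_order_term a n (Suc k)) \<longrightarrow>
     N \<le> (real n)\<^sup>2 * (\<Sum>k. second_order_term a n (Suc k))"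
proof -
  have \<sigma>0: "0 \<le> \<sigma>" using sums_le[OF _ sums_zero \<sigma>] by simp
  \<comment> \<open>17 = 9 + 4 * 2 collects the error constants, with the reflected sum at most 2
    \<sigma>; the added 1 keeps the denominator positive. The errors then use up at most half of the
    diagonal total 2 N.\<close>
  define \<epsilon> where "\<epsilon> = N / (17 * \<sigma> + 1)"
  have \<epsilon>: "\<epsilon> > 0" using N \<sigma>0 by (simp add: \<epsilon>_def)
  have \<epsilon>N: "\<epsilon> * (17 * \<sigma>) \<le> N"
  proof -
    have "\<epsilon> * (17 * \<sigma>) \<le> \<epsilon> * (17 * \<sigma> + 1)" using \<epsilon> by (intro mult_left_mono) auto
    then show ?thesis using \<sigma>0 by (simp add: \<epsilon>_def)
  qed
  obtain M where M: "\<And>k. k \<ge> M \<Longrightarrow> \<bar>real k * a k\<bar> < \<epsilon>"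
    using LIMSEQ_D[OF decay \<epsilon>] by auto
  show ?thesis
  proof (rule eventually_sequentiallyI[of "2 * M + 1"], rule impI)
    fix n assume n: "2 * M + 1 \<le> n" and s: "summable (\<lambda>k. second_order_term a n (Suc k))"
    \<comment> \<open>From n >= 2 M + 1 and n <= 2 j it follows that j > M.\<close>
    have small: "real j * \<bar>a j\<bar> \<le> \<epsilon>" if "n \<le> 2 * j" for j
      using M[of j] that n by (simp add: abs_mult)
    obtain \<tau> where \<tau>: "(\<lambda>k. \<bar>even_coeff a (int n - int (Suc k))\<bar>) sums \<tau>" "\<tau> \<le> 2 * \<sigma>"
      using reflected_coeff_sums[OF \<sigma>] by blast
    have "2 * N - \<epsilon> * (9 * \<sigma> + 4 * \<tau>) \<le> (real n)\<^sup>2 * (\<Sum>k. second_order_term a n (Suc k))"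
    proof (rule sums_le)
      show "(\<lambda>k. 2 * (a (Suc k))\<^sup>2 - \<epsilon> * (9 * \<bar>a (Suc k)\<bar> + 4 * \<bar>even_coeff a (int n - int (Suc k))\<bar>)) sums
          (2 * N - \<epsilon> * (9 * \<sigma> + 4 * \<tau>))"
        by (intro sums_diff sums_mult sums_add N \<sigma> \<tau>)
      show "(\<lambda>k. (real n)\<^sup>2 * second_order_term a n (Suc k)) sums ((real n)\<^sup>2 * (\<Sum>k. second_order_term a n (Suc k)))"
        by (intro sums_mult summable_sums s)
      show "2 * (a (Suc k))\<^sup>2 - \<epsilon> * (9 * \<bar>a (Suc k)\<bar> + 4 * \<bar>even_coeff a (int n - int (Suc k))\<bar>)
          \<le> (real n)\<^sup>2 * second_order_term a n (Suc k)" for k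
        by (rule second_order_term_ge) (use n small in auto)
    qed
    moreover have "\<epsilon> * (9 * \<sigma> + 4 * \<tau>) \<le> \<epsilon> * (17 * \<sigma>)"
      using \<tau>(2) \<epsilon> by (intro mult_left_mono) auto
    ultimately show "N \<le> (real n)\<^sup>2 * (\<Sum>k. second_order_term a n (Suc k))" using \<epsilon>N by linarith
  qed
qed

section \<open>Analytic branches and their radius of convergence\<close>

text \<open>It is not presupposed that - c is the linear coefficient: existence of the limit forces
  it. Subtracting the constant and cancelling the linear term leaves a series \<open>H\<close> whose
  first two coefficients vanish, and the next one is then the limit.\<close>

lemma fps_nth_2_eq_limit:
  fixes f :: "complex \<Rightarrow> complex"
  assumes f: "f has_fps_expansion F" and L: "((\<lambda>z. ((f z - f 0) / z + c) / z) \<longlongrightarrow> L) (at 0)"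
  shows "fps_nth F 2 = L"
proof -
  define H where "H = F - fps_const (f 0) + fps_const c * fps_X"
  define h where "h z = f z - f 0 + c * z" for z
  have h: "h has_fps_expansion H"
    unfolding h_def[abs_def] H_def by (intro fps_expansion_intros f)
  have H2: "fps_nth H 2 = fps_nth F 2" by (simp add: H_def)
  have lim2: "((\<lambda>z. h z / z ^ 2) \<longlongrightarrow> L) (at 0)"
    by (rule iffD1[OF LIM_equal L]) (auto simp: h_def power2_eq_square field_simps)
  have H0: "fps_nth H 0 = 0"
    using has_fps_expansion_imp_0_eq_fps_nth_0[OF f] by (simp add: H_def)
  have shift: "((\<lambda>z. h z / z ^ m) \<longlongrightarrow> fps_nth H m) (at 0)" if "m \<le> subdegree H" for m
  proof -
    define g where "g z = (if z = 0 then fps_nth H m else h z / z ^ m)" for z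
    have "g has_fps_expansion fps_shift m H"
      unfolding g_def[abs_def] by (rule has_fps_expansion_shift[OF h that refl])
    then have "isCont g 0" by (rule has_fps_expansion_imp_continuous)
    then have "(g \<longlongrightarrow> fps_nth H m) (at 0)"
      unfolding isCont_def by (simp only: g_def[of 0] simp_thms if_True)
    moreover have "\<forall>\<^sub>F z in at 0. g z = h z / z ^ m"
      using eventually_neq_at_within[of 0 0] by eventually_elim (simp add: g_def)
    ultimately show ?thesis by (rule Lim_transform_eventually)
  qed
  show ?thesis
  proof (cases "H = 0")
    case True
    then have "\<forall>\<^sub>F z in nhds 0. 0 = h z"
      using h by (simp add: has_fps_expansion_def)
    then have "\<forall>\<^sub>F z in at 0. h z / z ^ 2 = 0"
      by (rule eventually_mono[OF filter_leD[OF at_within_le_nhds]]) simp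
    then have "((\<lambda>z. h z / z ^ 2) \<longlongrightarrow> 0) (at 0)" by (rule tendsto_eventually)
    with lim2 have "L = 0" by (rule tendsto_unique[OF trivial_limit_at])
    then show ?thesis using True H2 by simp
  next
    case False
    \<comment> \<open>One factor z brings h(z) / z to the limit 0, which kills the linear
      coefficient of \<open>H\<close>.\<close>
    have "((\<lambda>z. z * (h z / z ^ 2)) \<longlongrightarrow> 0 * L) (at 0)" by (intro tendsto_mult lim2 tendsto_ident_at)
    then have "((\<lambda>z. h z / z ^ 1) \<longlongrightarrow> 0 * L) (at 0)"
      by (rule iffD1[OF LIM_equal, rotated]) (simp add: power2_eq_square)
    moreover have "1 \<le> subdegree H"
      using False H0 by (intro subdegree_geI) auto
    ultimately have "fps_nth H 1 = 0"
      using LIM_unique[OF _ shift[of 1]] by simp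
    then have "2 \<le> subdegree H"
      using False H0 by (intro subdegree_geI) (auto simp: less_2_cases_iff)
    from tendsto_unique[OF trivial_limit_at lim2 shift[OF this]] H2 show ?thesis by simp
  qed
qed

text \<open>Existence is the implicit function theorem at the simple zero n^2. A competing branch is
  continuous with the same value at 0, so near 0 it stays in the disc about n^2 where E z is the
  only zero; continuity alone thus forces analyticity.\<close>

lemma eigenvalue_branch_exists_unique:
  assumes v: "continuous_on {0..pi} v" and n: "n \<ge> 1"
  shows "\<exists>E. eigenvalue_branch v n E \<and> E analytic_on {0} \<and>
             (\<forall>F. eigenvalue_branch v n F \<longrightarrow> (\<forall>\<^sub>F z in nhds 0. F z = E z))"
proof -
  define \<Delta> where "\<Delta> z \<mu> = sol (pencil v z \<mu>) pi" for z \<mu>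
  obtain c where c: "c \<noteq> 0" "(\<Delta> 0 has_field_derivative c) (at ((of_nat n)\<^sup>2))"
    unfolding \<Delta>_def[abs_def] using sol_free_simple_zero[OF n] by blast
  have "continuous_on UNIV (\<lambda>p. (case (fst p, snd p, pi) of (z, \<mu>, x) \<Rightarrow> sol (pencil v z \<mu>) x))"
    by (rule continuous_on_compose2[OF continuous_on_sol_pencil[OF v pi_ge_zero]])
      (auto intro!: continuous_intros)
  then have 1: "continuous_on UNIV (\<lambda>(z, \<mu>). \<Delta> z \<mu>)"
    by (simp add: \<Delta>_def case_prod_beta')
  have 2: "\<Delta> z holomorphic_on UNIV" for z
    unfolding \<Delta>_def[abs_def]
    by (rule holomorphic_on_sol_pencil[OF v _ open_UNIV holomorphic_on_const holomorphic_on_ident]) auto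
  have 3: "(\<lambda>z. \<Delta> z (f z)) holomorphic_on A" if "open A" "f holomorphic_on A" for f A
    unfolding \<Delta>_def by (rule holomorphic_on_sol_pencil[OF v _ that(1) holomorphic_on_ident that(2)]) auto
  have 4: "\<Delta> 0 ((of_nat n)\<^sup>2) = 0"
    unfolding \<Delta>_def using sol_free_nat[OF n pi_ge_zero, of v] by (simp add: sin_npi)
  obtain E \<epsilon> \<delta> where E: "0 < \<epsilon>" "0 < \<delta>" "E holomorphic_on ball 0 \<delta>" "E 0 = (of_nat n)\<^sup>2"
    "\<And>z. z \<in> ball 0 \<delta> \<Longrightarrow> \<Delta> z (E z) = 0"
    "\<And>z \<mu>. z \<in> ball 0 \<delta> \<Longrightarrow> \<mu> \<in> cball ((of_nat n)\<^sup>2) \<epsilon> \<Longrightarrow> \<Delta> z \<mu> = 0 \<Longrightarrow> \<mu> = E z"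
    by (rule holomorphic_implicit_function[OF 1 2 3 4 c(2,1)], assumption, assumption, (rule that; blast))
  have near: "\<forall>\<^sub>F z in nhds (0::complex). z \<in> ball 0 \<delta>"
    using E(2) by (intro eventually_nhds_in_open) auto
  have an: "E analytic_on {0}"
    using E(2,3) by (auto simp: analytic_at intro!: exI[of _ "ball 0 \<delta>"])
  have "eigenvalue_branch v n E"
    unfolding eigenvalue_branch_def dirichlet_eigenvalue_iff[OF v]
    using E(4) analytic_at_imp_isCont[OF an] eventually_mono[OF near] E(5) by (auto simp: \<Delta>_def)
  moreover have "\<forall>\<^sub>F z in nhds 0. F z = E z" if F: "eigenvalue_branch v n F" for F
  proof -
    have F': "F 0 = (of_nat n)\<^sup>2" "isCont F 0" "\<forall>\<^sub>F z in nhds 0. \<Delta> z (F z) = 0"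
      using F unfolding eigenvalue_branch_def dirichlet_eigenvalue_iff[OF v] \<Delta>_def by auto
    have "\<forall>\<^sub>F z in nhds 0. F z \<in> ball ((of_nat n)\<^sup>2) \<epsilon>"
      using F'(1,2) E(1) by (intro topological_tendstoD[of F "F 0"]) (auto simp: isCont_def tendsto_nhds_iff)
    with near F'(3) show ?thesis
      by eventually_elim (rule E(6), auto)
  qed
  ultimately show ?thesis using an by blast
qed

text \<open>If the radius exceeded B, the summed series would be an eigenvalue on a disc of radius r
  > B. There |Im E| <= V r on the boundary circle, so |L| r^2 <= 2 V r, which contradicts 2 V <= |L|
  B.\<close>

lemma conv_radius_eigenvalue_branch_le:
  assumes v: "continuous_on {0..pi} v" "\<And>x. x \<in> {0..pi} \<Longrightarrow> \<bar>v x\<bar> \<le> V"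
    and n: "n \<ge> 1" and E: "eigenvalue_branch v n E"
    and L: "((\<lambda>z. ((E z - E 0) / z + c) / z) \<longlongrightarrow> L) (at 0)" and le: "2 * V \<le> norm L * B" "0 \<le> B" "L \<noteq> 0"
  shows "fps_conv_radius (fps_expansion E 0) \<le> ereal B"
proof (rule ccontr)
  define P where "P = fps_expansion E 0"
  assume "\<not> ?thesis"
  then have gt: "ereal B < fps_conv_radius P" by (simp add: P_def)
  \<comment> \<open>Two radii are needed: the coefficient bound uses the closed disc of radius r,
    and holomorphy holds on the larger open disc of radius r'.\<close>
  obtain r' where r': "B < r'" "ereal r' < fps_conv_radius P"
    using ereal_dense2[OF gt] by auto
  then obtain r where r: "B < r" "r < r'" using dense by blast
  have r0: "0 < r" using r le(2) by simp
  \<comment> \<open>E itself is only known to be continuous at 0. Its Taylor series is that of the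
    analytic branch with the same germ.\<close>
  obtain E1 where E1: "E1 analytic_on {0}" "\<forall>\<^sub>F z in nhds 0. E z = E1 z"
    using eigenvalue_branch_exists_unique[OF v(1) n] E by blast
  have "E1 has_fps_expansion fps_expansion E1 0"
    by (rule analytic_at_imp_has_fps_expansion_0[OF E1(1)])
  then have "E1 has_fps_expansion P"
    unfolding P_def using fps_expansion_cong[OF E1(2)] by simp
  then have EP: "E has_fps_expansion P"
    unfolding has_fps_expansion_def using E1(2) by (auto elim: eventually_elim2)
  have near: "\<forall>\<^sub>F z in nhds 0. eval_fps P z = E z"
    using EP by (simp add: has_fps_expansion_def)
  have hol: "eval_fps P holomorphic_on A" if "A \<subseteq> ball 0 r'" for A
  proof (rule holomorphic_on_eval_fps)
    show "A \<subseteq> eball 0 (fps_conv_radius P)"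
    proof
      fix z assume "z \<in> A"
      then have "ereal (norm z) < ereal r'" using that by auto
      then have "ereal (norm z) < fps_conv_radius P" using r'(2) by (rule less_trans)
      then show "z \<in> eball 0 (fps_conv_radius P)" by (simp add: in_eball_iff)
    qed
  qed
  define h where "h z = sol (pencil v z (eval_fps P z)) pi" for z
  have holh: "h holomorphic_on ball 0 r'"
    unfolding h_def[abs_def] by (rule holomorphic_on_sol_pencil[OF v(1) _ open_ball holomorphic_on_ident hol[OF order_refl]]) auto
  have "\<forall>\<^sub>F z in nhds 0. h z = 0"
    using near E unfolding eigenvalue_branch_def dirichlet_eigenvalue_iff[OF v(1)]
    by (auto simp: h_def elim: eventually_elim2)
  moreover have "\<forall>\<^sub>F z in nhds (0::complex). z \<in> ball 0 r'"
    using r r0 by (intro eventually_nhds_in_open) auto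
  ultimately have "\<forall>\<^sub>F z in nhds 0. h z = 0 \<and> z \<in> ball 0 r'" by (rule eventually_conj)
  then obtain S where S: "open S" "0 \<in> S" "\<And>z. z \<in> S \<Longrightarrow> h z = 0 \<and> z \<in> ball 0 r'"
    unfolding eventually_nhds by blast
  \<comment> \<open>The identity theorem carries the eigenvalue equation from a neighbourhood of 0
    to the whole disc, where the sum of the series need no longer equal E.\<close>
  have h0: "h z = 0" if "z \<in> ball 0 r'" for z
    by (rule analytic_continuation_open[of S "ball 0 r'" h "\<lambda>_. 0"])
      (use S holh that in \<open>auto intro!: convex_connected\<close>)
  have "norm ((deriv ^^ 2) (eval_fps P) 0) / 2 * r\<^sup>2 \<le> 2 * (V * r)"
  proof (rule second_deriv_bound_by_Im[OF hol r0])
    show "cball 0 r \<subseteq> ball 0 r'" using r by auto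
    fix z :: complex assume z: "norm z = r"
    then have "sol (pencil v z (eval_fps P z)) pi = 0" using h0[of z] r by (simp add: h_def)
    from Im_eigenvalue_le[OF v this] z show "\<bar>Im (eval_fps P z)\<bar> \<le> V * r" by simp
  qed
  moreover have "fps_nth P 2 = (deriv ^^ 2) (eval_fps P) 0 / fact 2"
    using EP by (intro fps_nth_fps_expansion eval_fps_has_fps_expansion) (simp add: has_fps_expansion_def)
  moreover have PL: "L = fps_nth P 2"
    by (rule fps_nth_2_eq_limit[OF EP L, symmetric])
  ultimately have "norm L * r\<^sup>2 \<le> 2 * (V * r)"
    by (simp only: norm_divide) (simp add: fact_2)
  then have "norm L * r \<le> 2 * V" using r0 by (simp add: power2_eq_square)
  also have "\<dots> \<le> norm L * B" by (rule le(1))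
  finally show False using r(1) le(3) by simp
qed

theorem proposition38:
  fixes a :: "nat \<Rightarrow> real" and v :: "real \<Rightarrow> real" and \<sigma> C :: real
  assumes v: "v = cosine_potential a"
    and nonzero: "\<exists>k\<ge>1. a k \<noteq> 0"
    and \<sigma>: "(\<lambda>k. \<bar>a (Suc k)\<bar>) sums \<sigma>"
    and decay: "(\<lambda>k. real k * a k) \<longlonglongrightarrow> 0"
    and C: "C = 32 * sqrt 2 * \<sigma> / (L2_norm_0_pi v)\<^sup>2"
  shows "(\<forall>n\<ge>1. \<exists>E. eigenvalue_branch v n E \<and> E analytic_on {0} \<and>
             (\<forall>F. eigenvalue_branch v n F \<longrightarrow> (\<forall>\<^sub>F z in nhds 0. F z = E z)))
       \<and> (\<forall>\<^sub>F n in sequentially. \<forall>E. eigenvalue_branch v n E \<longrightarrow>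
             fps_conv_radius (fps_expansion E 0) \<le> ereal (C * (real n)\<^sup>2))"
proof (intro conjI allI impI)
  have cv: "continuous_on S v" for S
    unfolding v by (rule continuous_on_cosine_potential[OF \<sigma>])
  show "\<exists>E. eigenvalue_branch v n E \<and> E analytic_on {0} \<and>
      (\<forall>F. eigenvalue_branch v n F \<longrightarrow> (\<forall>\<^sub>F z in nhds 0. F z = E z))" if "1 \<le> n" for n
    by (rule eigenvalue_branch_exists_unique[OF cv that])
  define N where "N = (L2_norm_0_pi v)\<^sup>2"
  have N: "(\<lambda>k. (a (Suc k))\<^sup>2) sums N"
    unfolding N_def v by (rule L2_norm_cosine_potential_sums[OF \<sigma>])
  have "N > 0"
  proof -
    obtain k where "a (Suc k) \<noteq> 0" using nonzero by (metis Suc_le_D One_nat_def)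
    then show ?thesis
      using suminf_pos2[OF sums_summable[OF N], of k] sums_unique[OF N] by simp
  qed
  have \<sigma>0: "0 \<le> \<sigma>" using sums_le[OF _ sums_zero \<sigma>] by simp
  show "\<forall>\<^sub>F n in sequentially. \<forall>E. eigenvalue_branch v n E \<longrightarrow>
             fps_conv_radius (fps_expansion E 0) \<le> ereal (C * (real n)\<^sup>2)"
    using eventually_second_order_ge[OF \<sigma> N \<open>N > 0\<close> decay] eventually_ge_at_top[of 1]
  proof eventually_elim
    case (elim n)
    show ?case
    proof (intro allI impI)
      fix E assume E: "eigenvalue_branch v n E"
      have E': "isCont E 0" "E 0 = (of_nat n)\<^sup>2" "\<forall>\<^sub>F z in nhds 0. sol (pencil (cosine_potential a) z (E z)) pi = 0"
        using E unfolding eigenvalue_branch_def dirichlet_eigenvalue_iff[OF cv] by (auto simp: v)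
      define S where "S = (\<Sum>k. second_order_term a n (Suc k))"
      have lim: "((\<lambda>z. ((E z - E 0) / z + of_real (a n / sqrt 2)) / z) \<longlongrightarrow> of_real (S / 8)) (at 0)"
        using eigenvalue_second_order(2)[OF \<sigma> elim(2) E'] unfolding S_def E'(2) .
      have NS: "N \<le> (real n)\<^sup>2 * S"
        using elim(1) eigenvalue_second_order(1)[OF \<sigma> elim(2) E'] by (simp add: S_def)
      have S: "S > 0"
      proof (rule ccontr)
        assume "\<not> S > 0"
        then have "(real n)\<^sup>2 * S \<le> 0" by (intro mult_nonneg_nonpos) auto
        with NS \<open>N > 0\<close> show False by simp
      qed
      show "fps_conv_radius (fps_expansion E 0) \<le> ereal (C * (real n)\<^sup>2)"
      proof (rule conv_radius_eigenvalue_branch_le[OF cv _ elim(2) E lim])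
        show "\<bar>v x\<bar> \<le> sqrt 2 * \<sigma>" for x
          unfolding v by (rule abs_cosine_potential_le[OF \<sigma>])
        \<comment> \<open>The second coefficient is S / 8 with S >= N / n^2, so 16 sqrt 2 \<sigma> /
          N would already do; the factor 4 on the right comes from 32 / 8 and is twice what is
          needed.\<close>
        have "2 * (sqrt 2 * \<sigma>) * N \<le> 4 * (sqrt 2 * \<sigma>) * ((real n)\<^sup>2 * S)"
          using NS \<open>N > 0\<close> \<sigma>0 by (intro mult_mono) auto
        then show "2 * (sqrt 2 * \<sigma>) \<le> norm (complex_of_real (S / 8)) * (C * (real n)\<^sup>2)"
          using S \<open>N > 0\<close> unfolding C N_def[symmetric] norm_of_real by (simp add: field_simps)
        show "0 \<le> C * (real n)\<^sup>2"
          using \<sigma>0 unfolding C by simp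
      qed (use S in auto)
    qed
  qed
qed

end
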